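(* Let $1\le p<\infty$, $1<q,q_1,q_2<\infty$, $\alpha_1,\alpha_2\in\mathbb{R}$ and $\beta>-n$, and let $v(x)=|x|_h^\beta$ on $\mathbb{H}^n$. Suppose that $\frac1{q_2}=\frac1q+\frac1{q_1}$ and $\frac1q+\frac{\alpha_2}{Q}=\frac{\alpha_1}{Q}$. Let $\Phi$ be a locally integrable function on $\mathbb{H}^n$ and let $A(y)$ be a $(2n+1)\times(2n+1)$ matrix-valued function on $\mathbb{H}^n$ with $\det A(y)\neq0$ for almost every $y$ in the support of $\Phi$. Then there is a constant $C>0$, independent of $f$, $b$, $\Phi$ and $A$, such that for all $b\in C\dot MO^q(\mathbb{H}^n;v)$ and $f\in\dot K^{\alpha_1,p}_{q_1}(\mathbb{H}^n;v)$ $$\|T^b_{\Phi,A}f\|_{\dot K^{\alpha_2,p}_{q_2}(\mathbb{H}^n;v)}\le C\,K_3\,\|b\|_{C\dot MO^q(\mathbb{H}^n;v)}\,\|f\|_{\dot K^{\alpha_1,p}_{q_1}(\mathbb{H}^n;v)},$$ where $$K_3=\begin{cases}\displaystyle\int_{\mathbb{H}^n}\Theta(y)\Big(1+\log_2\big(\|A^{-1}(y)\|\,\|A(y)\|\big)\Big)dy,&\text{if }\alpha_1=0,\\[2mm]\displaystyle\int_{\mathbb{H}^n}\Theta(y)\,G\big(A^{-1}(y),\alpha_1(Q+\beta)/Q\big)\,dy,&\text{if }\alpha_1\neq0,\end{cases}$$ and $$\begin{aligned}\Theta(y)&=\frac{|\Phi(y)|}{|y|_h^Q}|\det A^{-1}(y)|^{1/q_1}\Big(\log\frac{2}{\|A(y)\|}\,\chi_{\{\|A(y)\|<1\}}+\log\big(2\|A(y)\|\big)\,\chi_{\{\|A(y)\|\ge1\}}\Big)\\&\quad\times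 G\big(A^{-1}(y),\beta/q_1\big)\Big(1+|\det A^{-1}(y)|^{1/q}\,G\big(A^{-1}(y),\beta/q\big)\,\|A(y)\|^{(Q+\beta)/q}\Big).\end{aligned}$$
   Context: The Heisenberg group $\mathbb{H}^n$ is $\mathbb{R}^{2n}\times\mathbb{R}$ with the product $$x\cdot y=\Big(x_1+y_1,\dots,x_{2n}+y_{2n},\,x_{2n+1}+y_{2n+1}+2\sum_{j=1}^n(y_jx_{n+j}-x_jy_{n+j})\Big);$$ the identity is $0$ and $x^{-1}=-x$. Haar measure is Lebesgue measure on $\mathbb{R}^{2n+1}$, denoted $dx$, and $|E|$ is the measure of $E$. The homogeneous dimension is $Q=2n+2$. The homogeneous norm is $|x|_h=\big[(\sum_{i=1}^{2n}x_i^2)^2+x_{2n+1}^2\big]^{1/4}$, the distance is $d(x,y)=|y^{-1}x|_h$, and $B(x,r)=\{y: d(x,y)<r\}$. For a $(2n+1)\times(2n+1)$ matrix $M$ acting linearly on $\mathbb{R}^{2n+1}=\mathbb{H}^n$, put $\|M\|=\sup_{x\ne0}|Mx|_h/|x|_h$. $A^{-1}(y)$ denotes the inverse matrix of $A(y)$. For an invertible matrix $M$ and $\gamma\in\mathbb{R}$, $$G(M,\gamma)=\begin{cases}\|M\|^{\gamma}&\text{if }\gamma>0,\\ \|M^{-1}\|^{-\gamma}&\text{if }\gamma\le0.\end{cases}$$ $\chi_S$ denotes the indicator function of $S$. The matrix Hausdorff operator is $T_{\Phi,A}f(x)=\int_{\mathbb{H}^n}\frac{\Phi(y)}{|y|_h^Q}f(A(y)x)\,dy$,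 and its commutator with a locally integrable function $b$ is $T^b_{\Phi,A}f=b\,T_{\Phi,A}f-T_{\Phi,A}(bf)$, that is, $$T^b_{\Phi,A}f(x)=\int_{\mathbb{H}^n}\frac{\Phi(y)}{|y|_h^Q}\big(b(x)-b(A(y)x)\big)f(A(y)x)\,dy.$$ For a weight (non-negative locally integrable function) $w$ on $\mathbb{H}^n$, $w(E)=\int_E w(x)\,dx$ and $\|f\|_{L^q(E;w)}=\big(\int_E|f|^qw\,dx\big)^{1/q}$. Let $B_k=\{x\in\mathbb{H}^n:|x|_h<2^k\}$ and $E_k=B_k\setminus B_{k-1}$ for $k\in\mathbb{Z}$. For $\alpha\in\mathbb{R}$, $0<p,q<\infty$, the homogeneous weighted Herz space $\dot K^{\alpha,p}_q(\mathbb{H}^n;w)$ is the set of $f\in L^q_{\rm loc}(\mathbb{H}^n\setminus\{0\};w)$ with $$\|f\|_{\dot K^{\alpha,p}_q(\mathbb{H}^n;w)}=\Big\{\sum_{k=-\infty}^\infty w(B_k)^{\alpha p/Q}\|f\|_{L^q(E_k;w)}^p\Big\}^{1/p}<\infty.$$ For $1<q<\infty$, the weighted central BMO space $C\dot MO^q(\mathbb{H}^n;w)$ consists of the locally integrable $f\in L^q_{\rm loc}(\mathbb{H}^n;w)$ with $$\|f\|_{C\dot MO^q(\mathbb{H}^n;w)}=\sup_{R>0}\Big(\frac1{w(B(0,R))}\int_{B(0,R)}|f(x)-f_{B(0,R)}|^qw(x)\,dx\Big)^{1/q}<\infty,\qquad f_{B(0,R)}=\frac1{|B(0,R)|}\int_{B(0,R)}f(x)\,dx.$$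 The stated inequality has content only when $K_3$ is finite. *)

theory Defs
  imports "HOL-Analysis.Analysis"
begin

section \<open>The Heisenberg group\<close>

text \<open>
  The Heisenberg group of dimension \<open>2n+1\<close>, where \<open>n = CARD('n)\<close> is an arbitrary positive integer.
  The coordinates \<open>x\<^sub>j\<close>, \<open>x\<^sub>n\<^sub>+\<^sub>j\<close> (for \<open>j\<close> in \<open>'n\<close>) and \<open>x\<^sub>2\<^sub>n\<^sub>+\<^sub>1\<close> of a point \<open>x\<close> are
  \<open>x $ hl j\<close>, \<open>x $ hr j\<close> and \<open>x $ hz\<close>.  Haar measure is \<open>lebesgue\<close>.
\<close>

type_synonym 'n hidx = "'n + 'n + unit"
type_synonym 'n heis = "real ^ 'n hidx"
type_synonym 'n hmat = "real ^ 'n hidx ^ 'n hidx"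

abbreviation hl :: "'n \<Rightarrow> 'n hidx" where "hl j \<equiv> Inl j"
abbreviation hr :: "'n \<Rightarrow> 'n hidx" where "hr j \<equiv> Inr (Inl j)"
abbreviation hz :: "'n hidx" where "hz \<equiv> Inr (Inr ())"

definition hmult :: "'n::finite heis \<Rightarrow> 'n heis \<Rightarrow> 'n heis" where
  "hmult x y = x + y + axis hz (2 * (\<Sum>j\<in>UNIV. y $ hl j * x $ hr j - x $ hl j * y $ hr j))"

definition hdim :: "'n::finite itself \<Rightarrow> real" where
  "hdim _ = 2 * real CARD('n) + 2"

definition hnorm :: "'n::finite heis \<Rightarrow> real" where
  "hnorm x = root 4 ((\<Sum>j\<in>UNIV. (x $ hl j)\<^sup>2 + (x $ hr j)\<^sup>2)\<^sup>2 + (x $ hz)\<^sup>2)"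

text \<open>The inverse of \<open>y\<close> in the group is \<open>- y\<close>.\<close>

definition hdist :: "'n::finite heis \<Rightarrow> 'n heis \<Rightarrow> real" where
  "hdist x y = hnorm (hmult (- y) x)"

definition hball :: "'n::finite heis \<Rightarrow> real \<Rightarrow> 'n heis set" where
  "hball x r = {y. hdist x y < r}"

definition hB :: "int \<Rightarrow> 'n::finite heis set" where
  "hB k = {x. hnorm x < 2 powi k}"

definition hE :: "int \<Rightarrow> 'n::finite heis set" where
  "hE k = hB k - hB (k - 1)"


section \<open>Powers and logarithms in the extended half-line\<close>

text \<open>\<open>\<infinity>\<^sup>0 = 0\<^sup>0 = 1\<close>, and \<open>0\<close>, \<open>\<infinity>\<close> are exchanged by negative exponents.\<close>

definition epowr :: "ennreal \<Rightarrow> real \<Rightarrow> ennreal" where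
  "epowr x a =
     (if a = 0 then 1
      else if x = 0 then (if a > 0 then 0 else \<infinity>)
      else if x = \<infinity> then (if a > 0 then \<infinity> else 0)
      else ennreal (enn2real x powr a))"

text \<open>Logarithm to base \<open>a > 1\<close>, truncated below at \<open>0\<close>; it is only applied to arguments \<open>\<ge> 1\<close>.\<close>

definition elog :: "real \<Rightarrow> ennreal \<Rightarrow> ennreal" where
  "elog a x = (if x = \<infinity> then \<infinity> else ennreal (log a (enn2real x)))"


section \<open>Matrices acting on the Heisenberg group\<close>

text \<open>
  The supremum has to be taken in \<^typ>\<open>ennreal\<close>: \<open>hnorm\<close> is not homogeneous under scalar
  multiplication, so it is infinite for every matrix that mixes the \<open>hz\<close> coordinate with the
  others.
\<close>

definition hmnorm :: "'n::finite hmat \<Rightarrow> ennreal" where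
  "hmnorm M = (SUP x\<in>- {0}. ennreal (hnorm (M *v x) / hnorm x))"

definition hG :: "'n::finite hmat \<Rightarrow> real \<Rightarrow> ennreal" where
  "hG M \<gamma> = (if \<gamma> > 0 then epowr (hmnorm M) \<gamma> else epowr (hmnorm (matrix_inv M)) (- \<gamma>))"


section \<open>Function spaces\<close>

definition loc_integrable :: "('n::finite heis \<Rightarrow> complex) \<Rightarrow> bool" where
  "loc_integrable f \<longleftrightarrow> (\<forall>K. compact K \<longrightarrow> set_integrable lebesgue K f)"

definition wmeasure :: "('n::finite heis \<Rightarrow> real) \<Rightarrow> 'n heis set \<Rightarrow> ennreal" where
  "wmeasure w E = (\<integral>\<^sup>+x\<in>E. ennreal (w x) \<partial>lebesgue)"

definition Lnorm ::
  "'n::finite heis set \<Rightarrow> real \<Rightarrow> ('n heis \<Rightarrow> real) \<Rightarrow> ('n heis \<Rightarrow> complex) \<Rightarrow> ennreal" where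
  "Lnorm E q w f = epowr (\<integral>\<^sup>+x\<in>E. ennreal (norm (f x) powr q * w x) \<partial>lebesgue) (1 / q)"

definition Lloc ::
  "'n::finite heis set \<Rightarrow> real \<Rightarrow> ('n heis \<Rightarrow> real) \<Rightarrow> ('n heis \<Rightarrow> complex) set" where
  "Lloc U q w = {f \<in> borel_measurable lebesgue. \<forall>K. compact K \<and> K \<subseteq> U \<longrightarrow> Lnorm K q w f < \<infinity>}"

definition herz_norm ::
  "real \<Rightarrow> real \<Rightarrow> real \<Rightarrow> ('n::finite heis \<Rightarrow> real) \<Rightarrow> ('n heis \<Rightarrow> complex) \<Rightarrow> ennreal" where
  "herz_norm \<alpha> p q w f =
     epowr (\<Sum>\<^sub>\<infinity>k\<in>UNIV. epowr (wmeasure w (hB k)) (\<alpha> * p / hdim TYPE('n)) *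
                       epowr (Lnorm (hE k) q w f) p) (1 / p)"

definition herz ::
  "real \<Rightarrow> real \<Rightarrow> real \<Rightarrow> ('n::finite heis \<Rightarrow> real) \<Rightarrow> ('n heis \<Rightarrow> complex) set" where
  "herz \<alpha> p q w = {f \<in> Lloc (- {0}) q w. herz_norm \<alpha> p q w f < \<infinity>}"

definition average :: "'n::finite heis set \<Rightarrow> ('n heis \<Rightarrow> complex) \<Rightarrow> complex" where
  "average E f = (LINT x:E|lebesgue. f x) /\<^sub>R measure lebesgue E"

definition cmo_norm ::
  "real \<Rightarrow> ('n::finite heis \<Rightarrow> real) \<Rightarrow> ('n heis \<Rightarrow> complex) \<Rightarrow> ennreal" where
  "cmo_norm q w f =
     (SUP R\<in>{0<..}. epowr
        ((\<integral>\<^sup>+x\<in>hball 0 R. ennreal (norm (f x - average (hball 0 R) f) powr q * w x) \<partial>lebesgue)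
         / wmeasure w (hball 0 R)) (1 / q))"

definition cmo :: "real \<Rightarrow> ('n::finite heis \<Rightarrow> real) \<Rightarrow> ('n heis \<Rightarrow> complex) set" where
  "cmo q w = {f. loc_integrable f \<and> f \<in> Lloc UNIV q w \<and> cmo_norm q w f < \<infinity>}"


section \<open>The commutator of the matrix Hausdorff operator\<close>

definition comm_integrand ::
  "('n::finite heis \<Rightarrow> complex) \<Rightarrow> ('n heis \<Rightarrow> 'n hmat) \<Rightarrow> ('n heis \<Rightarrow> complex)
    \<Rightarrow> ('n heis \<Rightarrow> complex) \<Rightarrow> 'n heis \<Rightarrow> 'n heis \<Rightarrow> complex" where
  "comm_integrand \<Phi> A b f x y =
     \<Phi> y / of_real (hnorm y powr hdim TYPE('n)) * (b x - b (A y *v x)) * f (A y *v x)"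

definition hausdorff_comm ::
  "('n::finite heis \<Rightarrow> complex) \<Rightarrow> ('n heis \<Rightarrow> 'n hmat) \<Rightarrow> ('n heis \<Rightarrow> complex)
    \<Rightarrow> ('n heis \<Rightarrow> complex) \<Rightarrow> 'n heis \<Rightarrow> complex" where
  "hausdorff_comm \<Phi> A b f x = (LINT y|lebesgue. comm_integrand \<Phi> A b f x y)"

text \<open>
  \<open>Theta\<close> and \<open>K3\<close> take values in \<^typ>\<open>ennreal\<close>, where \<open>0 * \<infinity> = 0\<close>; so points with
  \<open>\<Phi> y = 0\<close> never contribute.
\<close>

definition Theta ::
  "real \<Rightarrow> real \<Rightarrow> real \<Rightarrow> ('n::finite heis \<Rightarrow> complex) \<Rightarrow> ('n heis \<Rightarrow> 'n hmat) \<Rightarrow> 'n heis \<Rightarrow> ennreal"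
  where
  "Theta q q1 \<beta> \<Phi> A y =
     (let Q = hdim TYPE('n); m = hmnorm (A y); A' = matrix_inv (A y) in
        ennreal (norm (\<Phi> y) / hnorm y powr Q) * ennreal (\<bar>det A'\<bar> powr (1 / q1))
        * (if m < 1 then elog (exp 1) (2 / m) else elog (exp 1) (2 * m))
        * hG A' (\<beta> / q1)
        * (1 + ennreal (\<bar>det A'\<bar> powr (1 / q)) * hG A' (\<beta> / q) * epowr m ((Q + \<beta>) / q)))"

definition K3 ::
  "real \<Rightarrow> real \<Rightarrow> real \<Rightarrow> real \<Rightarrow> ('n::finite heis \<Rightarrow> complex) \<Rightarrow> ('n heis \<Rightarrow> 'n hmat) \<Rightarrow> ennreal"
  where
  "K3 q q1 \<alpha>1 \<beta> \<Phi> A =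
     (if \<alpha>1 = 0
      then \<integral>\<^sup>+y. Theta q q1 \<beta> \<Phi> A y
                * (1 + elog 2 (hmnorm (matrix_inv (A y)) * hmnorm (A y))) \<partial>lebesgue
      else \<integral>\<^sup>+y. Theta q q1 \<beta> \<Phi> A y
                * hG (matrix_inv (A y)) (\<alpha>1 * (hdim TYPE('n) + \<beta>) / hdim TYPE('n)) \<partial>lebesgue)"

end

theory Submission
  imports Defs
begin

text \<open>The operator norm of the commutator is an average over \<open>y\<close> of the norms of the elementary operators
  \<open>f \<mapsto> (b - b \<circ> A(y)) (f \<circ> A(y))\<close>, by Minkowski's integral inequality, used once in
  \<open>L\<^sup>q\<^sup>2(E\<^sub>k; v)\<close> and once in the sequence space over \<open>k\<close>.  Hence it suffices to bound one elementary
  operator by \<open>C \<cdot> kernel_bound\<close>, the integrand of \<open>K3\<close>.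

  Fix \<open>M = A(y)\<close> and write \<open>M'\<close> for its inverse.  On the shell \<open>E\<^sub>k\<close>, Hoelder's inequality with
  \<open>1/q\<^sub>2 = 1/q + 1/q\<^sub>1\<close> separates the two factors.

  \<^item> The factor \<open>b - b \<circ> M\<close> (\<open>pnorm_difference_le\<close>).  Choose \<open>j\<close> with \<open>2\<^sup>j\<close> comparable to \<open>\<parallel>M\<parallel>\<close>, so that
    \<open>M\<close> maps \<open>B\<^sub>k\<close> into \<open>B\<^sub>k\<^sub>+\<^sub>j\<close>, and compare \<open>b(x)\<close> with the average \<open>c\<^sub>k\<close> over \<open>B\<^sub>k\<close> and \<open>b(M x)\<close> with the
    average \<open>c\<^sub>k\<^sub>+\<^sub>j\<close>.  These two terms are controlled by the central mean oscillation, the second one after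
    the change of variables \<open>M x = z\<close>.  The difference \<open>c\<^sub>k\<^sub>+\<^sub>j - c\<^sub>k\<close> costs one oscillation norm for each dyadic
    step, which produces the logarithm in \<open>Theta\<close>.  Two consecutive averages are compared by the
    weighted \<open>L\<^sup>q\<close> norm of the constant \<open>c\<^sub>k\<^sub>+\<^sub>1 - c\<^sub>k\<close> on \<open>B\<^sub>k\<close>; the weight enters only through
    \<open>v(B\<^sub>k) = c\<^sub>0 2\<^sup>k\<^sup>s\<close> with \<open>s = Q + \<beta>\<close> (\<open>hweight_hB\<close>), a consequence of the dilations of the group.

  \<^item> The factor \<open>f \<circ> M\<close> (\<open>pnorm_hE_matrix_le\<close>).  The change of variables bounds it by the norm of \<open>f\<close> on
    \<open>M E\<^sub>k\<close>.  This set meets the shell \<open>E\<^sub>k\<^sub>+\<^sub>m\<close> only if \<open>1 / (2 \<parallel>M'\<parallel>) < 2\<^sup>m < 2 \<parallel>M\<parallel>\<close>, a window of indices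
    \<open>m\<close> that does not depend on \<open>k\<close>.

  Together the two factors bound the \<open>k\<close>-th term by the sum of the norms of \<open>f\<close> on \<open>E\<^sub>k\<^sub>+\<^sub>m\<close> over the
  window, and \<open>v(B\<^sub>k)\<^sup>1\<^sup>/\<^sup>q\<close> raises the Herz exponent from \<open>\<alpha>\<^sub>2\<close> to \<open>\<alpha>\<^sub>1\<close>.  Shifting a Herz sequence by \<open>m\<close>
  multiplies its norm by \<open>2\<^sup>-\<^sup>m\<^sup>\<sigma>\<close> with \<open>\<sigma> = \<alpha>\<^sub>1 (Q + \<beta>) / Q\<close> (\<open>pnorm_shift\<close>).  The sum of these factors over
  the window is a geometric series dominated by its extreme term, \<open>\<parallel>M'\<parallel>\<^sup>\<sigma>\<close> or \<open>\<parallel>M\<parallel>\<^sup>-\<^sup>\<sigma>\<close>, unless \<open>\<sigma> = 0\<close>;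
  then it is the number of indices, at most \<open>3 (1 + log\<^sub>2 (\<parallel>M'\<parallel> \<parallel>M\<parallel>))\<close> (\<open>shift_sum_indices_bound\<close>).

  All norms take values in the extended half-line, so the estimates for a single matrix also hold when a
  matrix norm is infinite.  The functions \<open>\<Phi>\<close>, \<open>A\<close>, \<open>b\<close> and \<open>f\<close> are replaced by Borel representatives; since
  an invertible matrix preserves null sets, this changes the kernel only on a null set of pairs
  \<open>(x, y)\<close>.\<close>

section \<open>Powers in the extended half-line\<close>

lemma epowr_0 [simp]: "a > 0 \<Longrightarrow> epowr 0 a = 0"
  and epowr_top [simp]: "a > 0 \<Longrightarrow> epowr top a = top"
  and epowr_1 [simp]: "epowr 1 a = 1"
  and epowr_exp_0 [simp]: "epowr x 0 = 1"
  by (auto simp: epowr_def)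

lemma epowr_ennreal: "x \<ge> 0 \<Longrightarrow> a > 0 \<Longrightarrow> epowr (ennreal x) a = ennreal (x powr a)"
  by (auto simp: epowr_def ennreal_eq_0_iff)

lemma epowr_ennreal_pos: "x > 0 \<Longrightarrow> epowr (ennreal x) a = ennreal (x powr a)"
  by (auto simp: epowr_def ennreal_eq_0_iff)

lemma epowr_mono:
  assumes "a \<ge> 0" "x \<le> y" shows "epowr x a \<le> epowr y a"
proof (cases "a = 0 \<or> y = \<infinity>")
  case False
  then obtain r s where "x = ennreal r" "y = ennreal s" "r \<ge> 0" "s \<ge> 0"
    using assms(2) by (metis ennreal_cases infinity_ennreal_def neq_top_trans)
  with assms False show ?thesis by (auto simp: epowr_ennreal intro!: ennreal_leI powr_mono2)
qed (cases "a = 0"; use assms in auto)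

lemma epowr_mult:
  assumes "a \<ge> 0" shows "epowr (x * y) a = epowr x a * epowr y a"
proof (cases "a = 0")
  case False
  with assms have a: "a > 0" by simp
  show ?thesis
  proof (cases "x = 0 \<or> y = 0 \<or> x = \<infinity> \<or> y = \<infinity>")
    case True
    then show ?thesis using a
      by (auto simp: epowr_def ennreal_mult_top ennreal_top_mult ennreal_mult_eq_top_iff enn2real_eq_0_iff)
  next
    case False
    then obtain r s where "x = ennreal r" "y = ennreal s" "r \<ge> 0" "s \<ge> 0"
      by (metis ennreal_cases infinity_ennreal_def)
    with a show ?thesis by (simp add: epowr_ennreal powr_mult flip: ennreal_mult)
  qed
qed auto

lemma epowr_epowr:
  assumes "a > 0" "b > 0" shows "epowr (epowr x a) b = epowr x (a * b)"
proof (cases x)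
  case (real r)
  then show ?thesis using assms by (simp add: epowr_ennreal powr_powr)
qed (use assms in auto)

lemma epowr_add:
  assumes "a \<ge> 0" "b \<ge> 0" shows "epowr x (a + b) = epowr x a * epowr x b"
proof (cases "a = 0 \<or> b = 0")
  case False
  with assms have "a > 0" "b > 0" by auto
  then show ?thesis 
    by (cases x) (auto simp: epowr_ennreal powr_add ennreal_mult ennreal_mult_top epowr_top)
qed auto

lemma epowr_exp_1 [simp]: "epowr x 1 = x"
  by (cases x) (auto simp: epowr_ennreal epowr_top)

lemma epowr_inverse_exp [simp]:
  "a > 0 \<Longrightarrow> epowr (epowr x a) (1 / a) = x" "a > 0 \<Longrightarrow> epowr (epowr x (1 / a)) a = x"
  by (simp_all add: epowr_epowr)

text \<open>Powers with positive exponent are order isomorphisms of the extended half-line; this adjunction gives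
  continuity along suprema.\<close>

lemma epowr_le_iff:
  assumes "a > 0" shows "epowr x a \<le> y \<longleftrightarrow> x \<le> epowr y (1 / a)"
  using epowr_mono[of a x "epowr y (1/a)"] epowr_mono[of "1/a" "epowr x a" y] assms by auto

lemma epowr_eq_0_iff: "a > 0 \<Longrightarrow> epowr x a = 0 \<longleftrightarrow> x = 0"
  by (cases x) (auto simp: epowr_ennreal ennreal_eq_0_iff)

lemma epowr_eq_top_iff: "a > 0 \<Longrightarrow> epowr x a = top \<longleftrightarrow> x = top"
  by (cases x) (auto simp: epowr_ennreal)

lemma epowr_Sup:
  assumes "a > 0" shows "epowr (SUP i\<in>I. X i) a = (SUP i\<in>I. epowr (X i) a)"
proof (rule antisym)
  show "epowr (SUP i\<in>I. X i) a \<le> (SUP i\<in>I. epowr (X i) a)"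
    unfolding epowr_le_iff[OF assms]
    by (rule SUP_least, subst epowr_le_iff[OF assms, symmetric], rule SUP_upper)
  show "(SUP i\<in>I. epowr (X i) a) \<le> epowr (SUP i\<in>I. X i) a"
    using assms by (intro SUP_least epowr_mono SUP_upper) auto
qed

lemma measurable_epowr [measurable (raw)]:
  assumes f: "f \<in> borel_measurable M" shows "(\<lambda>x. epowr (f x) a) \<in> borel_measurable M"
proof -
  have "(\<lambda>x. ennreal (enn2real x powr a)) \<in> borel_measurable borel" by measurable
  moreover have "{x \<in> space borel. x = c} \<in> sets borel" for c :: ennreal by simp
  ultimately have "(\<lambda>x. epowr x a) \<in> borel_measurable borel"
    unfolding epowr_def by (intro measurable_If measurable_const) auto
  from measurable_compose[OF f this] show ?thesis .
qed

lemma epowr_indicator: "a > 0 \<Longrightarrow> epowr (g * indicator E x) a = epowr g a * indicator E x"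
  by (auto simp: indicator_def)

section \<open>Lebesgue norms of extended nonnegative functions\<close>

text \<open>The functions have values in the extended half-line, where every integral exists; restriction to a set is expressed by an indicator factor.\<close>

definition pnorm :: "'a measure \<Rightarrow> real \<Rightarrow> ('a \<Rightarrow> ennreal) \<Rightarrow> ennreal" where
  "pnorm M r g = epowr (\<integral>\<^sup>+x. epowr (g x) r \<partial>M) (1 / r)"

lemma pnorm_mono_AE:
  assumes "r > 0" "AE x in M. f x \<le> g x" shows "pnorm M r f \<le> pnorm M r g"
  unfolding pnorm_def using assms
  by (intro epowr_mono nn_integral_mono_AE) (auto elim!: eventually_mono intro: epowr_mono)

lemma pnorm_cmult:
  assumes "r > 0" and [measurable]: "f \<in> borel_measurable M"
  shows "pnorm M r (\<lambda>x. c * f x) = c * pnorm M r f"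
  using assms by (simp add: pnorm_def epowr_mult nn_integral_cmult)

lemma Youngs_inequality_ennreal:
  assumes "p > 1" "q > 1" "1 / p + 1 / q = (1::real)"
  shows "a * b \<le> ennreal (1 / p) * epowr a p + ennreal (1 / q) * epowr b q"
proof (cases "a = \<infinity> \<or> b = \<infinity>")
  case True
  with assms show ?thesis by (auto simp: ennreal_mult_top)
next
  case False
  then obtain r s where rs: "a = ennreal r" "b = ennreal s" "r \<ge> 0" "s \<ge> 0"
    by (metis ennreal_cases infinity_ennreal_def)
  then show ?thesis
    using Youngs_inequality[OF assms rs(3,4)] assms
    by (simp add: epowr_ennreal flip: ennreal_mult ennreal_plus)
qed

lemma ennreal_inverse_mult: "x \<noteq> 0 \<Longrightarrow> x \<noteq> \<infinity> \<Longrightarrow> inverse x * x = (1::ennreal)"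
  by (cases x) (auto simp: inverse_ennreal ennreal_eq_0_iff simp flip: ennreal_mult)

text \<open>Both factors are normalised to norm \<open>1\<close> and Young's inequality is integrated; this needs norms that are
  neither \<open>0\<close> nor \<open>\<infinity>\<close>.\<close>

lemma Hoelder_conjugate:
  assumes pq: "p > 1" "q > 1" "1 / p + 1 / q = (1::real)"
    and [measurable]: "f \<in> borel_measurable M" "g \<in> borel_measurable M"
  shows "(\<integral>\<^sup>+x. f x * g x \<partial>M) \<le> pnorm M p f * pnorm M q g"
proof -
  let ?a = "pnorm M p f" and ?b = "pnorm M q g"
  have ia: "(\<integral>\<^sup>+x. epowr (f x) p \<partial>M) = epowr ?a p" and ib: "(\<integral>\<^sup>+x. epowr (g x) q \<partial>M) = epowr ?b q"
    using pq by (simp_all add: pnorm_def)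
  consider "?a = 0 \<or> ?b = 0" | "?a \<noteq> 0" "?b \<noteq> 0" "?a = \<infinity> \<or> ?b = \<infinity>"
    | "?a \<noteq> 0" "?b \<noteq> 0" "?a \<noteq> \<infinity>" "?b \<noteq> \<infinity>" by blast
  then show ?thesis
  proof cases
    case 1
    then have "(AE x in M. f x = 0) \<or> (AE x in M. g x = 0)"
      using ia ib pq by (auto simp: nn_integral_0_iff_AE epowr_eq_0_iff)
    then have "AE x in M. f x * g x = 0" by (auto elim!: eventually_mono)
    then have "(\<integral>\<^sup>+x. f x * g x \<partial>M) = 0" by (subst nn_integral_0_iff_AE) auto
    then show ?thesis by simp
  next
    case 2
    then have "?a * ?b = \<infinity>" by (auto simp: ennreal_mult_eq_top_iff)
    then show ?thesis by simp
  next
    case 3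
    have na: "epowr (inverse ?a * f x) p = epowr (inverse ?a) p * epowr (f x) p"
      and nb: "epowr (inverse ?b * g x) q = epowr (inverse ?b) q * epowr (g x) q" for x
      using pq by (auto simp: epowr_mult)
    have "(\<integral>\<^sup>+x. (inverse ?a * f x) * (inverse ?b * g x) \<partial>M) \<le>
      (\<integral>\<^sup>+x. ennreal (1 / p) * epowr (inverse ?a * f x) p + ennreal (1 / q) * epowr (inverse ?b * g x) q \<partial>M)"
      by (intro nn_integral_mono Youngs_inequality_ennreal pq)
    also have "\<dots> = ennreal (1 / p) * (epowr (inverse ?a) p * epowr ?a p)
        + ennreal (1 / q) * (epowr (inverse ?b) q * epowr ?b q)"
      unfolding na nb by (simp add: nn_integral_add nn_integral_cmult ia ib)
    also have "\<dots> = 1"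
      using pq 3 by (simp flip: epowr_mult ennreal_plus add: ennreal_inverse_mult)
    finally have "(\<integral>\<^sup>+x. (inverse ?a * inverse ?b) * (f x * g x) \<partial>M) \<le> 1"
      by (simp add: mult_ac)
    then have "(inverse ?a * inverse ?b) * (\<integral>\<^sup>+x. f x * g x \<partial>M) \<le> 1"
      by (simp add: nn_integral_cmult)
    then have "(?a * ?b) * ((inverse ?a * inverse ?b) * (\<integral>\<^sup>+x. f x * g x \<partial>M)) \<le> ?a * ?b * 1"
      by (rule mult_left_mono) simp
    moreover have "(?a * ?b) * ((inverse ?a * inverse ?b) * (\<integral>\<^sup>+x. f x * g x \<partial>M))
      = (inverse ?a * ?a) * (inverse ?b * ?b) * (\<integral>\<^sup>+x. f x * g x \<partial>M)" by (simp add: mult_ac)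
    ultimately show ?thesis using 3 by (simp add: ennreal_inverse_mult)
  qed
qed

text \<open>Apply the conjugate case to the \<open>r\<close>-th powers with the exponents \<open>p / r\<close> and \<open>q / r\<close>.\<close>

lemma Hoelder:
  assumes pq: "p > 0" "q > 0" "r > 0" "1 / r = 1 / p + 1 / (q::real)"
    and [measurable]: "f \<in> borel_measurable M" "g \<in> borel_measurable M"
  shows "pnorm M r (\<lambda>x. f x * g x) \<le> pnorm M p f * pnorm M q g"
proof -
  have "1 / p < 1 / r" "1 / q < 1 / r" unfolding pq(4) using pq(1,2) by auto
  then have gt: "p / r > 1" "q / r > 1" using pq(1-3) by (simp_all add: field_simps)
  have "1 / (p / r) + 1 / (q / r) = r * (1 / p + 1 / q)" by (simp add: algebra_simps)
  then have sum: "1 / (p / r) + 1 / (q / r) = 1"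
    using pq(3) by (simp flip: pq(4))
  have "(\<integral>\<^sup>+x. epowr (f x * g x) r \<partial>M) \<le>
      pnorm M (p / r) (\<lambda>x. epowr (f x) r) * pnorm M (q / r) (\<lambda>x. epowr (g x) r)"
    using Hoelder_conjugate[OF gt sum, of "\<lambda>x. epowr (f x) r" M "\<lambda>x. epowr (g x) r"] pq(3)
    by (simp add: epowr_mult)
  also have "\<dots> = epowr (pnorm M p f * pnorm M q g) r"
    using pq(1-3) by (simp add: pnorm_def epowr_epowr epowr_mult)
  finally show ?thesis
    using pq(3) by (simp add: pnorm_def epowr_le_iff)
qed

text \<open>With \<open>H x = \<integral> F x y dy\<close>, one writes \<open>\<integral> H\<^sup>p = \<integral>\<integral> F x y H\<^sup>p\<^sup>-\<^sup>1 dx dy\<close>, applies Hoelder's inequality in \<open>x\<close>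
  and cancels a power of \<open>\<integral> H\<^sup>p\<close>.  The cancellation is legitimate only if this integral is finite, so it
  is done for truncations of \<open>H\<close>, which increase to \<open>H\<close>.\<close>

lemma Minkowski_integral:
  assumes "p \<ge> (1::real)" and "sigma_finite_measure M" and "sigma_finite_measure N"
    and F: "(\<lambda>(x, y). F x y) \<in> borel_measurable (M \<Otimes>\<^sub>M N)"
  shows "pnorm M p (\<lambda>x. \<integral>\<^sup>+y. F x y \<partial>N) \<le> (\<integral>\<^sup>+y. pnorm M p (\<lambda>x. F x y) \<partial>N)"
proof -
  interpret M: sigma_finite_measure M by fact
  interpret N: sigma_finite_measure N by fact
  interpret pair_sigma_finite M N ..
  note [measurable] = F
  have [measurable]: "(\<lambda>x. F x y) \<in> borel_measurable M" if "y \<in> space N" for y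
    using that F by measurable
  have Fp: "(\<lambda>y. pnorm M p (\<lambda>x. F x y)) \<in> borel_measurable N"
  proof -
    have "(\<lambda>(y, x). epowr (F x y) p) \<in> borel_measurable (N \<Otimes>\<^sub>M M)"
      using measurable_pair_swap[OF F] by (intro measurable_epowr[of "\<lambda>(y, x). F x y", unfolded case_prod_beta] | simp add: case_prod_beta)+
    then have "(\<lambda>y. \<integral>\<^sup>+x. epowr (F x y) p \<partial>M) \<in> borel_measurable N"
      by (rule M.borel_measurable_nn_integral)
    then show ?thesis unfolding pnorm_def by (rule measurable_epowr)
  qed
  show ?thesis
  proof (cases "p = 1")
    case True
    then show ?thesis by (simp add: pnorm_def Fubini' F)
  next
    case False
    with assms have p: "p > 1" by simp
    \<comment> \<open>The exponent conjugate to \<open>p\<close>.\<close>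
    define p' where "p' = p / (p - 1)"
    have p': "p' > 1" "1 / p + 1 / p' = 1" "(p - 1) * p' = p"
      using p by (auto simp: p'_def field_simps)
    define H where "H x = (\<integral>\<^sup>+y. F x y \<partial>N)" for x
    have [measurable]: "H \<in> borel_measurable M" unfolding H_def by measurable
    obtain S :: "nat \<Rightarrow> 'a set" where S: "range S \<subseteq> sets M" "(\<Union>i. S i) = space M"
      "\<And>i. emeasure M (S i) \<noteq> \<infinity>" "incseq S"
      using M.sigma_finite_incseq by metis
    have [measurable]: "S n \<in> sets M" for n using S by auto
    \<comment> \<open>Bounded and supported on a set of finite measure, hence with a finite \<open>p\<close>-th moment.\<close>
    define Hn where "Hn n x = min (H x) (of_nat n) * indicator (S n) x" for n x
    have [measurable]: "Hn n \<in> borel_measurable M" for n unfolding Hn_def by measurable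
    let ?R = "\<integral>\<^sup>+y. pnorm M p (\<lambda>x. F x y) \<partial>N"
    have bound: "epowr (\<integral>\<^sup>+x. epowr (Hn n x) p \<partial>M) (1 / p) \<le> ?R" (is "epowr ?J _ \<le> _") for n
    proof -
      have "?J \<le> (\<integral>\<^sup>+x. epowr (of_nat n) p * indicator (S n) x \<partial>M)"
        using p by (intro nn_integral_mono)
          (auto simp: Hn_def indicator_def intro: epowr_mono)
      also have "\<dots> = epowr (of_nat n) p * emeasure M (S n)" by (simp add: nn_integral_cmult_indicator)
      also have "\<dots> < \<infinity>"
        using S(3)[of n] p epowr_eq_top_iff[of p "of_nat n"]
        by (auto simp: ennreal_mult_less_top top.not_eq_extremum)
      finally have fin: "?J \<noteq> \<infinity>" by simp
      have "?J \<le> (\<integral>\<^sup>+x. H x * epowr (Hn n x) (p - 1) \<partial>M)"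
      proof (rule nn_integral_mono)
        fix x
        have "epowr (Hn n x) p = Hn n x * epowr (Hn n x) (p - 1)"
          using epowr_add[of 1 "p - 1" "Hn n x"] p by simp
        also have "\<dots> \<le> H x * epowr (Hn n x) (p - 1)"
          by (rule mult_right_mono) (auto simp: Hn_def indicator_def)
        finally show "epowr (Hn n x) p \<le> H x * epowr (Hn n x) (p - 1)" .
      qed
      also have "\<dots> = (\<integral>\<^sup>+x. \<integral>\<^sup>+y. F x y * epowr (Hn n x) (p - 1) \<partial>N \<partial>M)"
        unfolding H_def by (intro nn_integral_cong) (simp add: nn_integral_multc)
      also have "\<dots> = (\<integral>\<^sup>+y. \<integral>\<^sup>+x. F x y * epowr (Hn n x) (p - 1) \<partial>M \<partial>N)"
        by (intro Fubini'[symmetric]) measurable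
      also have "\<dots> \<le> (\<integral>\<^sup>+y. pnorm M p (\<lambda>x. F x y) * pnorm M p' (\<lambda>x. epowr (Hn n x) (p - 1)) \<partial>N)"
        by (rule nn_integral_mono, rule Hoelder_conjugate[OF p p'(1,2)]) auto
      also have "\<dots> = ?R * pnorm M p' (\<lambda>x. epowr (Hn n x) (p - 1))"
        by (rule nn_integral_multc[OF Fp])
      also have "pnorm M p' (\<lambda>x. epowr (Hn n x) (p - 1)) = epowr ?J (1 / p')"
        using p p'(1,3) by (simp add: pnorm_def epowr_epowr)
      finally have *: "?J \<le> ?R * epowr ?J (1 / p')" .
      have spl: "?J = epowr ?J (1 / p) * epowr ?J (1 / p')"
        using epowr_add[of "1/p" "1/p'" ?J] p p'(1,2) by simp
      show ?thesis
      proof (cases "?J = 0")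
        case False
        let ?e = "epowr ?J (1 / p')"
        have e: "?e \<noteq> 0" "?e \<noteq> \<infinity>"
          using False fin p'(1) by (auto simp: epowr_eq_0_iff epowr_eq_top_iff)
        have "epowr ?J (1 / p) * ?e \<le> ?R * ?e" unfolding spl[symmetric] by (rule *)
        with e show ?thesis
          by (simp add: ennreal_mult_le_mult_iff mult.commute[of _ ?e] less_top)
      qed (use p in simp)
    qed
    have inc: "incseq (\<lambda>n x. epowr (Hn n x) p)"
      unfolding incseq_def le_fun_def Hn_def
      using S(4) p by (auto intro!: epowr_mono mult_mono simp: incseq_def indicator_def min_le_iff_disj)
    have sup: "epowr (H x) p = (SUP n. epowr (Hn n x) p)" if x: "x \<in> space M" for x
    proof -
      obtain n0 where n0: "x \<in> S n0" using S(2) x by blast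
      have "H x = inf (H x) (SUP n. of_nat n)" by (simp add: ennreal_SUP_of_nat_eq_top)
      also have "\<dots> = (SUP n. min (H x) (of_nat n))" unfolding inf_SUP by (simp add: inf_min)
      also have "\<dots> \<le> (SUP n. Hn n x)"
      proof (rule SUP_mono)
        fix n
        have "x \<in> S (max n n0)" using incseqD[OF S(4), of n0 "max n n0"] n0 by auto
        then have "min (H x) (of_nat n) \<le> Hn (max n n0) x"
          by (auto simp: Hn_def min_le_iff_disj)
        then show "\<exists>m\<in>UNIV. min (H x) (of_nat n) \<le> Hn m x" by blast
      qed
      finally have "H x \<le> (SUP n. Hn n x)" .
      moreover have "(SUP n. Hn n x) \<le> H x"
        by (intro SUP_least) (auto simp: Hn_def indicator_def)
      ultimately have "H x = (SUP n. Hn n x)" by (rule antisym)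
      then show ?thesis using p by (simp add: epowr_Sup)
    qed
    have "(\<integral>\<^sup>+x. epowr (H x) p \<partial>M) = (\<integral>\<^sup>+x. (SUP n. epowr (Hn n x) p) \<partial>M)"
      by (intro nn_integral_cong) (rule sup)
    also have "\<dots> = (SUP n. \<integral>\<^sup>+x. epowr (Hn n x) p \<partial>M)"
      by (rule nn_integral_monotone_convergence_SUP[OF inc]) measurable
    finally have "pnorm M p H = (SUP n. epowr (\<integral>\<^sup>+x. epowr (Hn n x) p \<partial>M) (1 / p))"
      using p by (simp add: pnorm_def epowr_Sup)
    also have "\<dots> \<le> ?R" using bound by (intro SUP_least) auto
    finally show ?thesis unfolding H_def .
  qed
qed

text \<open>The countable triangle inequality is Minkowski's inequality for a counting measure.\<close>

lemma pnorm_nn_integral_count_space: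
  assumes "r \<ge> 1" "sigma_finite_measure M" "countable I" "\<And>i. i \<in> I \<Longrightarrow> F i \<in> borel_measurable M"
  shows "pnorm M r (\<lambda>x. \<integral>\<^sup>+i. F i x \<partial>count_space I) \<le> (\<integral>\<^sup>+i. pnorm M r (F i) \<partial>count_space I)"
proof (rule Minkowski_integral[OF assms(1,2)])
  show "sigma_finite_measure (count_space I)"
    by (rule sigma_finite_measure_count_space_countable) fact
  show "(\<lambda>(x, i). F i x) \<in> borel_measurable (M \<Otimes>\<^sub>M count_space I)"
    using assms(3,4) by (subst measurable_pair_swap_iff) (intro measurable_pair_measure_countable1, auto)
qed

lemma pnorm_add:
  assumes "r \<ge> 1" "sigma_finite_measure M" "f \<in> borel_measurable M" "g \<in> borel_measurable M"
  shows "pnorm M r (\<lambda>x. f x + g x) \<le> pnorm M r f + pnorm M r g"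
  using pnorm_nn_integral_count_space[OF assms(1,2), of "UNIV :: bool set" "\<lambda>i. if i then f else g"] assms(3,4)
  by (simp add: nn_integral_count_space_finite UNIV_bool add.commute)

lemma pnorm_indicator:
  assumes "r > 0" "E \<in> sets M" shows "pnorm M r (\<lambda>x. c * indicator E x) = c * epowr (emeasure M E) (1 / r)"
  using assms by (simp add: pnorm_cmult) (simp add: pnorm_def epowr_indicator[of r 1, simplified])

text \<open>Scaling maps the simple functions below \<open>h\<close> to those below \<open>c h\<close>.  This is applied to the integrand of
  \<open>K3\<close>, where matrix norms are suprema over an uncountable family.\<close>

lemma nn_integral_cmult_le:
  assumes "c < \<infinity>" shows "(\<integral>\<^sup>+x. c * h x \<partial>M) \<le> c * (\<integral>\<^sup>+x. h x \<partial>M)"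
proof (cases "c = 0")
  case False
  have c: "inverse c * c = 1" "c * inverse c = 1"
    using ennreal_inverse_mult[OF False] assms by (auto simp: mult.commute)
  show ?thesis
    unfolding nn_integral_def[of M "\<lambda>x. c * h x"]
  proof (rule SUP_least, safe)
    fix g assume g: "simple_function M g" "g \<le> (\<lambda>x. c * h x)"
    have [measurable]: "g \<in> borel_measurable M" using g(1) by (rule borel_measurable_simple_function)
    have "inverse c * g x \<le> h x" for x
    proof -
      have "inverse c * g x \<le> inverse c * (c * h x)" using g(2) by (intro mult_left_mono) (auto simp: le_fun_def)
      then show ?thesis by (simp add: c flip: mult.assoc)
    qed
    then have "(\<integral>\<^sup>+x. inverse c * g x \<partial>M) \<le> (\<integral>\<^sup>+x. h x \<partial>M)" by (rule nn_integral_mono)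
    then have "c * (inverse c * (\<integral>\<^sup>+x. g x \<partial>M)) \<le> c * (\<integral>\<^sup>+x. h x \<partial>M)"
      by (intro mult_left_mono) (simp_all add: nn_integral_cmult)
    then show "integral\<^sup>S M g \<le> c * integral\<^sup>N M h"
      using g(1) by (simp add: c nn_integral_eq_simple_integral flip: mult.assoc)
  qed
qed simp

lemma infsum_ennreal_eq_nn_integral:
  fixes f :: "'a \<Rightarrow> ennreal"
  assumes A: "countable A" "infinite A"
  shows "infsum f A = (\<integral>\<^sup>+x. f x \<partial>count_space A)"
proof -
  obtain e :: "nat \<Rightarrow> 'a" where e: "bij_betw e UNIV A"
    using bij_betw_from_nat_into[OF A] by blast
  have "infsum f A = infsum (\<lambda>n. f (e n)) UNIV"
    by (rule infsum_reindex_bij_betw[OF e, symmetric])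
  also have "\<dots> = (\<Sum>n. f (e n))"
    by (intro sums_unique has_sum_imp_sums has_sum_infsum nonneg_summable_on_complete) simp
  also have "\<dots> = (\<integral>\<^sup>+n. f (e n) \<partial>count_space UNIV)"
    by (rule nn_integral_count_space_nat[symmetric])
  also have "\<dots> = (\<integral>\<^sup>+x. f x \<partial>count_space A)"
    by (rule nn_integral_bij_count_space[OF e])
  finally show ?thesis .
qed

section \<open>Linear change of variables\<close>

text \<open>By Fubini's theorem one may integrate over the coordinate along \<open>b\<close> first; there the shear is a
  translation.\<close>

lemma nn_integral_lborel_shear:
  fixes g :: "'a::euclidean_space \<Rightarrow> ennreal"
  assumes [measurable]: "g \<in> borel_measurable borel" and b: "b \<in> Basis" "b' \<in> Basis" "b \<noteq> b'"
  shows "(\<integral>\<^sup>+x. g (x + (c * (x \<bullet> b')) *\<^sub>R b) \<partial>lborel) = (\<integral>\<^sup>+x. g x \<partial>lborel)"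
proof -
  interpret product_sigma_finite "\<lambda>_::'a. lborel :: real measure" ..
  let ?I = "Basis - {b} :: 'a set"
  define R where "R x = (\<Sum>i\<in>?I. x i *\<^sub>R i)" for x :: "'a \<Rightarrow> real"
  have I: "insert b ?I = Basis" "finite ?I" "b \<notin> ?I" using b by auto
  have S: "(\<Sum>i\<in>Basis. (x(b := y)) i *\<^sub>R i) = y *\<^sub>R b + R x" for x y
  proof -
    have "(\<Sum>i\<in>Basis. (x(b := y)) i *\<^sub>R i) = y *\<^sub>R b + (\<Sum>i\<in>?I. (x(b := y)) i *\<^sub>R i)"
      using b by (simp add: sum.remove)
    also have "(\<Sum>i\<in>?I. (x(b := y)) i *\<^sub>R i) = R x" unfolding R_def by (rule sum.cong) auto
    finally show ?thesis .
  qed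
  have R: "R x \<bullet> b' = x b'" for x
  proof -
    have "R x \<bullet> b' = (\<Sum>i\<in>?I. if i = b' then x i else 0)"
      unfolding R_def inner_sum_left using b by (intro sum.cong) (auto simp: inner_Basis)
    then show ?thesis using b by simp
  qed
  have F: "(\<integral>\<^sup>+x. h x \<partial>lborel) = (\<integral>\<^sup>+x. \<integral>\<^sup>+y. h (y *\<^sub>R b + R x) \<partial>lborel \<partial>Pi\<^sub>M ?I (\<lambda>_. lborel))"
    if [measurable]: "h \<in> borel_measurable borel" for h :: "'a \<Rightarrow> ennreal"
  proof -
    have "(\<integral>\<^sup>+x. h x \<partial>lborel) = (\<integral>\<^sup>+f. h (\<Sum>i\<in>Basis. f i *\<^sub>R i) \<partial>Pi\<^sub>M Basis (\<lambda>_. lborel))"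
      by (subst lborel_eq, subst nn_integral_distr) auto
    also have "\<dots> = (\<integral>\<^sup>+f. h (\<Sum>i\<in>Basis. f i *\<^sub>R i) \<partial>Pi\<^sub>M (insert b ?I) (\<lambda>_. lborel))"
      unfolding I ..
    also have "\<dots> = (\<integral>\<^sup>+x. \<integral>\<^sup>+y. h (\<Sum>i\<in>Basis. (x(b := y)) i *\<^sub>R i) \<partial>lborel \<partial>Pi\<^sub>M ?I (\<lambda>_. lborel))"
      by (rule product_nn_integral_insert[OF I(2,3)]) (unfold I, measurable)
    finally show ?thesis unfolding S .
  qed
  have "(\<integral>\<^sup>+x. g (x + (c * (x \<bullet> b')) *\<^sub>R b) \<partial>lborel)
    = (\<integral>\<^sup>+x. \<integral>\<^sup>+y. g ((y *\<^sub>R b + R x) + (c * ((y *\<^sub>R b + R x) \<bullet> b')) *\<^sub>R b) \<partial>lborel \<partial>Pi\<^sub>M ?I (\<lambda>_. lborel))"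
    by (rule F) measurable
  also have "\<dots> = (\<integral>\<^sup>+x. \<integral>\<^sup>+y. g (y *\<^sub>R b + R x) \<partial>lborel \<partial>Pi\<^sub>M ?I (\<lambda>_. lborel))"
  proof (rule nn_integral_cong)
    fix x
    have "(\<integral>\<^sup>+y. g (y *\<^sub>R b + R x) \<partial>lborel) = (\<integral>\<^sup>+y. g ((c * x b' + 1 * y) *\<^sub>R b + R x) \<partial>lborel)"
      by (subst nn_integral_real_affine[of _ 1 "c * x b'"]) auto
    then show "(\<integral>\<^sup>+y. g ((y *\<^sub>R b + R x) + (c * ((y *\<^sub>R b + R x) \<bullet> b')) *\<^sub>R b) \<partial>lborel)
      = (\<integral>\<^sup>+y. g (y *\<^sub>R b + R x) \<partial>lborel)"
      using b by (simp add: inner_add_left R inner_Basis scaleR_add_left add_ac)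
  qed
  also have "\<dots> = (\<integral>\<^sup>+x. g x \<partial>lborel)" by (rule F[symmetric]) measurable
  finally show ?thesis .
qed

lemma borel_measurable_vec_lambda [measurable (raw)]:
  assumes "\<And>i. (\<lambda>x. h x i) \<in> borel_measurable M"
  shows "(\<lambda>x. \<chi> i. h x i :: real^'n) \<in> borel_measurable M"
  by (subst borel_measurable_euclidean_space) (use assms in \<open>auto simp: Basis_vec_def inner_axis\<close>)

lemma borel_measurable_vec_nth [measurable (raw)]:
  "f \<in> borel_measurable M \<Longrightarrow> (\<lambda>x. (f x :: 'a::euclidean_space^'n) $ i) \<in> borel_measurable M"
  by (rule measurable_compose[where g = "\<lambda>v. v $ i"])
    (auto intro!: borel_measurable_continuous_onI continuous_intros)

lemma borel_measurable_axis [measurable (raw)]: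
  "f \<in> borel_measurable M \<Longrightarrow> (\<lambda>x. axis i (f x) :: real^'n) \<in> borel_measurable M"
  unfolding axis_def by (rule borel_measurable_vec_lambda, rename_tac j, case_tac "j = i") auto

lemma nn_integral_lborel_shear_cart:
  fixes g :: "real^'n \<Rightarrow> ennreal"
  assumes "g \<in> borel_measurable borel" "m \<noteq> n"
  shows "(\<integral>\<^sup>+x. g (x + axis m (c * x $ n)) \<partial>lborel) = (\<integral>\<^sup>+x. g x \<partial>lborel)"
proof -
  have "axis m (c * x $ n) = (c * (x \<bullet> axis n 1)) *\<^sub>R (axis m 1 :: real^'n)" for x :: "real^'n"
    unfolding inner_axis by (simp add: vec_eq_iff axis_def)
  then show ?thesis
    using nn_integral_lborel_shear[of g "axis m 1" "axis n 1" c] assms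
    by (auto simp: Basis_vec_def axis_eq_axis)
qed

lemma nn_integral_lborel_diagonal:
  fixes g :: "real^'n \<Rightarrow> ennreal"
  assumes [measurable]: "g \<in> borel_measurable borel" and c: "\<And>i. c i \<noteq> 0"
  shows "ennreal \<bar>\<Prod>i\<in>UNIV. c i\<bar> * (\<integral>\<^sup>+x. g (\<chi> i. c i * x $ i) \<partial>lborel) = (\<integral>\<^sup>+x. g x \<partial>lborel)"
proof -
  define c' where "c' = (\<lambda>b::real^'n. c (axis_index b))"
  have inj: "inj (\<lambda>i::'n. axis i (1::real))" by (auto simp: inj_on_def axis_eq_axis)
  have B: "(Basis :: (real^'n) set) = range (\<lambda>i. axis i 1)" by (auto simp: Basis_vec_def)
  have ix: "axis_index (axis i (1::real)) = (i::'n)" for i by (simp add: axis_index_def axis_eq_axis)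
  have T: "0 + (\<Sum>j\<in>Basis. (c' j * (x \<bullet> j)) *\<^sub>R j) = (\<chi> i. c i * x $ i)" for x :: "real^'n"
    unfolding B using inj
    by (simp add: sum.reindex ix c'_def inner_axis) (simp add: vec_eq_iff axis_def if_distrib cong: if_cong)
  have P: "(\<Prod>j\<in>(Basis :: (real^'n) set). \<bar>c' j\<bar>) = \<bar>\<Prod>i\<in>UNIV. c i\<bar>"
    unfolding B using inj by (simp add: prod.reindex ix c'_def abs_prod)
  have meas: "(\<lambda>x::real^'n. \<chi> i. c i * x $ i) \<in> lborel \<rightarrow>\<^sub>M borel" by measurable
  have "lborel = density (distr lborel borel (\<lambda>x. \<chi> i. c i * x $ i)) (\<lambda>_. ennreal \<bar>\<Prod>i\<in>UNIV. c i\<bar>)"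
    using lborel_affine_euclidean[of c' "0 :: real^'n"] c unfolding T P by (simp add: c'_def)
  then have "(\<integral>\<^sup>+x. g x \<partial>lborel)
      = (\<integral>\<^sup>+x. g x \<partial>density (distr lborel borel (\<lambda>x. \<chi> i. c i * x $ i)) (\<lambda>_. ennreal \<bar>\<Prod>i\<in>UNIV. c i\<bar>))"
    by simp
  also have "\<dots> = ennreal \<bar>\<Prod>i\<in>UNIV. c i\<bar> * (\<integral>\<^sup>+x. g (\<chi> i. c i * x $ i) \<partial>lborel)"
    by (subst nn_integral_density) (auto simp: nn_integral_cmult nn_integral_distr[OF meas])
  finally show ?thesis ..
qed

text \<open>A transposition of coordinates is a product of three shears and a reflection.\<close>

lemma nn_integral_lborel_swap:
  fixes g :: "real^'n \<Rightarrow> ennreal"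
  assumes g [measurable]: "g \<in> borel_measurable borel" and mn: "m \<noteq> n"
  shows "(\<integral>\<^sup>+x. g (\<chi> i. x $ Transposition.transpose m n i) \<partial>lborel) = (\<integral>\<^sup>+x. g x \<partial>lborel)"
proof -
  let ?s = "\<lambda>m n c (x::real^'n). x + axis m (c * x $ n)"
  let ?d = "\<lambda>x::real^'n. \<chi> i. (if i = n then - 1 else 1) * x $ i"
  \<comment> \<open>\<open>(a, b) \<mapsto> (a + b, b) \<mapsto> (a + b, - a) \<mapsto> (b, - a) \<mapsto> (b, a)\<close> in the coordinates \<open>m\<close> and \<open>n\<close>.\<close>
  have *: "(\<chi> i. x $ Transposition.transpose m n i) = ?d (?s m n 1 (?s n m (- 1) (?s m n 1 x)))" for x :: "real^'n"
    using mn by (auto simp: vec_eq_iff axis_def Transposition.transpose_def)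
  have "(\<integral>\<^sup>+x. g (\<chi> i. x $ Transposition.transpose m n i) \<partial>lborel) = (\<integral>\<^sup>+x. g (?d (?s m n 1 (?s n m (- 1) x))) \<partial>lborel)"
    unfolding * using mn
    by (intro nn_integral_lborel_shear_cart[of "\<lambda>x. g (?d (?s m n 1 (?s n m (- 1) x)))" m n 1]) measurable
  also have "\<dots> = (\<integral>\<^sup>+x. g (?d (?s m n 1 x)) \<partial>lborel)"
    using mn by (intro nn_integral_lborel_shear_cart[of "\<lambda>x. g (?d (?s m n 1 x))" n m "- 1"]) auto
  also have "\<dots> = (\<integral>\<^sup>+x. g (?d x) \<partial>lborel)"
    using mn by (intro nn_integral_lborel_shear_cart[of "\<lambda>x. g (?d x)" m n 1]) auto
  also have "\<dots> = (\<integral>\<^sup>+x. g x \<partial>lborel)"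
    using nn_integral_lborel_diagonal[OF g, of "\<lambda>i. if i = n then - 1 else 1"]
    by (simp add: abs_prod if_distrib[of abs])
  finally show ?thesis .
qed

lemma borel_measurable_matrix_vector_mult [measurable]:
  "(\<lambda>x. (A :: real^'n^'m) *v x) \<in> borel_measurable borel"
  by (intro borel_measurable_continuous_onI matrix_vector_mult_linear_continuous_on)

text \<open>Both sides are multiplicative in \<open>A\<close>, so it suffices to treat elementary matrices.\<close>

theorem nn_integral_lborel_matrix:
  fixes A :: "real^'n^'n" and g :: "real^'n \<Rightarrow> ennreal"
  assumes "det A \<noteq> 0" "g \<in> borel_measurable borel"
  shows "ennreal \<bar>det A\<bar> * (\<integral>\<^sup>+x. g (A *v x) \<partial>lborel) = (\<integral>\<^sup>+x. g x \<partial>lborel)"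
  using assms
proof (induction A arbitrary: g rule: induct_matrix_elementary[case_names mult zero_row diagonal swap1 idplus])
  case (mult A B)
  note [measurable] = mult.prems(2)
  have nz: "det A \<noteq> 0" "det B \<noteq> 0" using mult.prems by (auto simp: det_mul)
  have "(\<integral>\<^sup>+x. g x \<partial>lborel) = ennreal \<bar>det A\<bar> * (\<integral>\<^sup>+x. g (A *v x) \<partial>lborel)"
    using mult.IH(1)[OF nz(1)] by simp
  also have "(\<integral>\<^sup>+x. g (A *v x) \<partial>lborel) = ennreal \<bar>det B\<bar> * (\<integral>\<^sup>+x. g (A *v (B *v x)) \<partial>lborel)"
    using mult.IH(2)[OF nz(2), of "\<lambda>x. g (A *v x)"] by simp
  finally show ?case
    by (simp add: det_mul abs_mult ennreal_mult mult.assoc matrix_vector_mul_assoc)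
next
  case (zero_row A i)
  then show ?case by (simp add: det_zero_row)
next
  case (diagonal A)
  have "A *v x = (\<chi> i. A $ i $ i * x $ i)" for x
  proof -
    have "(\<Sum>j\<in>UNIV. A $ i $ j * x $ j) = (\<Sum>j\<in>UNIV. if j = i then A $ i $ i * x $ i else 0)" for i
      using diagonal(1) by (intro sum.cong) auto
    then show ?thesis by (simp add: matrix_vector_mult_def)
  qed
  moreover have "det A = (\<Prod>i\<in>UNIV. A $ i $ i)" using diagonal(1) by (rule det_diagonal)
  ultimately show ?case
    using nn_integral_lborel_diagonal[of g "\<lambda>i. A $ i $ i"] diagonal by auto
next
  case (swap1 m n)
  let ?S = "\<chi> i j. mat 1 $ i $ Transposition.transpose m n j :: real^'n^'n"
  have "?S *v x = (\<chi> i. x $ Transposition.transpose m n i)" for x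
  proof -
    have "(\<Sum>j\<in>UNIV. (mat 1 :: real^'n^'n) $ i $ Transposition.transpose m n j * x $ j)
      = (\<Sum>j\<in>UNIV. if j = Transposition.transpose m n i then x $ j else 0)" for i
      by (intro sum.cong) (auto simp: mat_def Transposition.transpose_def)
    then show ?thesis by (simp add: matrix_vector_mult_def)
  qed
  moreover have "\<bar>det ?S\<bar> = 1"
    using det_permute_columns[of "Transposition.transpose m n" "mat 1 :: real^'n^'n"]
    by (simp add: permutes_swap_id sign_swap_id swap1)
  ultimately show ?case using nn_integral_lborel_swap[of g m n] swap1 by simp
next
  case (idplus m n c)
  let ?S = "\<chi> i j. if i = m \<and> j = n then c else of_bool (i = j) :: real^'n^'n"
  have "?S *v x = x + axis m (c * x $ n)" for x
  proof -
    have "(\<Sum>j\<in>UNIV. (if i = m \<and> j = n then c else of_bool (i = j)) * x $ j)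
      = (\<Sum>j\<in>UNIV. (if j = i then x $ j else 0) + (if j = n then if i = m then c * x $ j else 0 else 0))" for i
      using idplus(1) by (intro sum.cong) auto
    also have "\<dots> i = x $ i + (if i = m then c * x $ n else 0)" for i
      by (simp add: sum.distrib)
    finally show ?thesis by (simp add: matrix_vector_mult_def vec_eq_iff axis_def)
  qed
  moreover have "?S = (\<chi> k. if k = m then row m (mat 1) + c *s row n (mat 1) else row k (mat 1))"
    using idplus(1) by (auto simp: vec_eq_iff row_def mat_def)
  then have "det ?S = 1" using det_row_operation[OF idplus(1), of "mat 1 :: real^'n^'n" c] by simp
  ultimately show ?case using nn_integral_lborel_shear_cart[of g m n c] idplus by simp
qed

lemma invertible_matrix_inv:
  assumes "det (A :: real^'n^'n) \<noteq> 0"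
  shows "A ** matrix_inv A = mat 1" "matrix_inv A ** A = mat 1"
    and "A *v (matrix_inv A *v x) = x" "matrix_inv A *v (A *v x) = x"
    and "matrix_inv (matrix_inv A) = A" "det (matrix_inv A) = 1 / det A"
proof -
  have ex: "\<exists>B. A ** B = mat 1 \<and> B ** A = mat 1"
    using assms invertible_det_nz[of A] unfolding invertible_def by blast
  show 1: "A ** matrix_inv A = mat 1" and 2: "matrix_inv A ** A = mat 1"
    using someI_ex[OF ex] unfolding matrix_inv_def by auto
  show "A *v (matrix_inv A *v x) = x" "matrix_inv A *v (A *v x) = x"
    by (simp_all add: matrix_vector_mul_assoc 1 2)
  have "\<exists>B. matrix_inv A ** B = mat 1 \<and> B ** matrix_inv A = mat 1" using 1 2 by blast
  from someI_ex[OF this] have 3: "matrix_inv A ** matrix_inv (matrix_inv A) = mat 1"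
    unfolding matrix_inv_def[of "matrix_inv A"] by auto
  then have "A ** (matrix_inv A ** matrix_inv (matrix_inv A)) = A" by simp
  then show "matrix_inv (matrix_inv A) = A" by (simp add: matrix_mul_assoc 1)
  have "det A * det (matrix_inv A) = 1" using 1 det_mul[of A "matrix_inv A"] by simp
  then show "det (matrix_inv A) = 1 / det A" using assms by (simp add: field_simps)
qed

lemma AE_lborel_matrix:
  fixes A :: "real^'n^'n"
  assumes "det A \<noteq> 0" and N: "N \<in> null_sets lborel"
  shows "AE x in lborel. A *v x \<notin> N"
proof -
  have [measurable]: "N \<in> sets borel" using N by auto
  have "ennreal \<bar>det A\<bar> * (\<integral>\<^sup>+x. indicator N (A *v x) \<partial>lborel) = 0"
    using nn_integral_lborel_matrix[OF assms(1), of "indicator N"] by (simp add: null_setsD1[OF N])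
  then have "(\<integral>\<^sup>+x. indicator N (A *v x) \<partial>lborel) = 0" using assms(1) by simp
  then have "AE x in lborel. indicator N (A *v x) = (0::ennreal)"
    by (subst (asm) nn_integral_0_iff_AE) auto
  then show ?thesis by (auto elim!: eventually_mono split: split_indicator_asm)
qed

section \<open>The homogeneous norm\<close>

lemma hnorm_nonneg [simp]: "hnorm x \<ge> 0"
  by (simp add: hnorm_def)

lemma hnorm_power4: "hnorm x ^ 4 = (\<Sum>j\<in>UNIV. (x $ hl j)\<^sup>2 + (x $ hr j)\<^sup>2)\<^sup>2 + (x $ hz)\<^sup>2"
  by (simp add: hnorm_def)

lemma all_hidx: "(\<forall>i. P (i :: 'n hidx)) \<longleftrightarrow> (\<forall>j. P (hl j)) \<and> (\<forall>j. P (hr j)) \<and> P hz"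
proof safe
  fix i assume P: "\<forall>j. P (hl j)" "\<forall>j. P (hr j)" "P hz"
  show "P i"
  proof (cases i)
    case (Inr k)
    then show ?thesis using P by (cases k) auto
  qed (use P in auto)
qed auto

lemma hnorm_coordinate_le:
  "(x $ hl j)\<^sup>2 \<le> (hnorm x)\<^sup>2" "(x $ hr j)\<^sup>2 \<le> (hnorm x)\<^sup>2" "\<bar>x $ hz\<bar> \<le> (hnorm x)\<^sup>2"
proof -
  let ?S = "\<Sum>j\<in>UNIV. (x $ hl j)\<^sup>2 + (x $ hr j)\<^sup>2"
  have S: "?S\<^sup>2 \<le> ((hnorm x)\<^sup>2)\<^sup>2" and z: "(x $ hz)\<^sup>2 \<le> ((hnorm x)\<^sup>2)\<^sup>2"
    using hnorm_power4[of x] by (simp_all flip: power_mult)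
  have S': "?S \<le> (hnorm x)\<^sup>2" using power2_le_imp_le[OF S] by simp
  have "(x $ hl j)\<^sup>2 + (x $ hr j)\<^sup>2 \<le> ?S"
    by (rule member_le_sum) auto
  then show "(x $ hl j)\<^sup>2 \<le> (hnorm x)\<^sup>2" "(x $ hr j)\<^sup>2 \<le> (hnorm x)\<^sup>2"
    using S' by (smt (verit) zero_le_power2)+
  show "\<bar>x $ hz\<bar> \<le> (hnorm x)\<^sup>2" by (rule power2_le_imp_le) (use z in simp_all)
qed

lemma hnorm_0 [simp]: "hnorm 0 = 0"
  by (simp add: hnorm_def)

lemma hnorm_eq_0_iff [simp]: "hnorm x = 0 \<longleftrightarrow> x = 0"
proof
  assume "hnorm x = 0"
  then show "x = 0" using hnorm_coordinate_le[of x] by (simp add: vec_eq_iff all_hidx)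
qed simp

lemma hnorm_pos_iff [simp]: "hnorm x > 0 \<longleftrightarrow> x \<noteq> 0"
  using hnorm_nonneg[of x] hnorm_eq_0_iff[of x] by linarith

lemma continuous_on_hnorm: "continuous_on S hnorm"
  unfolding hnorm_def by (intro continuous_intros)

lemma borel_measurable_hnorm [measurable]: "hnorm \<in> borel_measurable borel"
  by (rule borel_measurable_continuous_onI[OF continuous_on_hnorm])

text \<open>The centre has homogeneity \<open>2\<close>, which explains the bound \<open>r\<^sup>2\<close> for the last coordinate.\<close>

lemma bounded_hnorm_le: "bounded {x :: 'n::finite heis. hnorm x \<le> r}"
proof (rule bounded_subset)
  let ?c = "(\<chi> i. max r (r\<^sup>2)) :: 'n heis"
  show "bounded (cbox (- ?c) ?c)" by simp
  show "{x :: 'n heis. hnorm x \<le> r} \<subseteq> cbox (- ?c) ?c"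
  proof
    fix x :: "'n heis" assume "x \<in> {x. hnorm x \<le> r}"
    then have r: "hnorm x \<le> r" "r \<ge> 0" using hnorm_nonneg[of x] by (auto simp del: hnorm_nonneg)
    then have r2: "(hnorm x)\<^sup>2 \<le> r\<^sup>2" by (simp add: power_mono)
    have "\<bar>x $ hl j\<bar> \<le> r" "\<bar>x $ hr j\<bar> \<le> r" for j
      using hnorm_coordinate_le(1,2)[of x j] r r2 abs_le_square_iff[of "x $ hl j" r] abs_le_square_iff[of "x $ hr j" r]
      unfolding abs_of_nonneg[OF r(2)] by linarith+
    moreover have "\<bar>x $ hz\<bar> \<le> r\<^sup>2" using hnorm_coordinate_le(3)[of x] r2 by linarith
    ultimately have "\<forall>i. \<bar>x $ i\<bar> \<le> max r (r\<^sup>2)" unfolding all_hidx by (auto simp: le_max_iff_disj)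
    then show "x \<in> cbox (- ?c) ?c" by (auto simp: mem_box_cart abs_le_iff) (smt (verit))+
  qed
qed

lemma hnorm_uminus [simp]: "hnorm (- x) = hnorm x"
  by (simp add: hnorm_def)

lemma hball_0: "hball 0 r = {x. hnorm x < r}"
  by (simp add: hball_def hdist_def hmult_def axis_def vec_eq_iff flip: zero_vec_def)

lemma hB_eq_hball: "hB k = hball 0 (2 powi k)"
  by (simp add: hB_def hball_0)

lemma hdim_pos: "hdim TYPE('n::finite) > 0"
  by (simp add: hdim_def)

lemma powi_2_eq_powr: "(2::real) powi k = 2 powr of_int k"
  by (simp add: powr_real_of_int')

lemma sets_hB [measurable]: "hB k \<in> sets borel" and sets_hE [measurable]: "hE k \<in> sets borel"
  unfolding hE_def hB_def by measurable

lemma hE_iff: "x \<in> hE k \<longleftrightarrow> 2 powr (of_int k - 1) \<le> hnorm x \<and> hnorm x < 2 powr of_int k"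
  by (auto simp: hE_def hB_def powi_2_eq_powr)

lemma ex_hE:
  assumes "x \<noteq> 0" shows "\<exists>k. x \<in> hE k"
proof
  let ?L = "log 2 (hnorm x)"
  have x: "2 powr ?L = hnorm x" using assms by simp
  have "2 powr of_int \<lfloor>?L\<rfloor> \<le> 2 powr ?L" "2 powr ?L < 2 powr of_int (\<lfloor>?L\<rfloor> + 1)"
    by (simp, subst powr_less_cancel_iff) (simp, linarith)
  then show "x \<in> hE (\<lfloor>?L\<rfloor> + 1)"
    unfolding hE_iff x by simp
qed

text \<open>The automorphic dilations of the Heisenberg group, for which \<open>hnorm\<close> is homogeneous of degree \<open>1\<close>.\<close>

definition hdil :: "real \<Rightarrow> 'n::finite heis \<Rightarrow> 'n heis" where
  "hdil t x = (\<chi> i. (case i of Inr (Inr _) \<Rightarrow> t\<^sup>2 | _ \<Rightarrow> t) * x $ i)"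

lemma hdil_nth [simp]:
  "hdil t x $ hl j = t * x $ hl j" "hdil t x $ hr j = t * x $ hr j" "hdil t x $ hz = t\<^sup>2 * x $ hz"
  by (simp_all add: hdil_def)

lemma hnorm_hdil:
  assumes "t > 0" shows "hnorm (hdil t x) = t * hnorm x"
proof -
  let ?S = "\<Sum>j\<in>UNIV. (x $ hl j)\<^sup>2 + (x $ hr j)\<^sup>2"
  have "(\<Sum>j\<in>UNIV. (hdil t x $ hl j)\<^sup>2 + (hdil t x $ hr j)\<^sup>2) = t\<^sup>2 * ?S"
    by (simp add: power_mult_distrib sum_distrib_left distrib_left)
  then have "hnorm (hdil t x) ^ 4 = (t\<^sup>2 * ?S)\<^sup>2 + (t\<^sup>2 * x $ hz)\<^sup>2"
    unfolding hnorm_power4 by simp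
  also have "\<dots> = t ^ 4 * hnorm x ^ 4"
    unfolding hnorm_power4 by (simp add: power_mult_distrib distrib_left flip: power_mult)
  finally have "hnorm (hdil t x) ^ 4 = (t * hnorm x) ^ 4" by (simp add: power_mult_distrib)
  then show ?thesis using assms by (simp add: power_eq_iff_eq_base)
qed

text \<open>The Jacobian is \<open>t\<^sup>2\<^sup>n \<cdot> t\<^sup>2\<close>; this is where the homogeneous dimension comes from.\<close>

lemma nn_integral_hdil:
  fixes g :: "'n::finite heis \<Rightarrow> ennreal"
  assumes t: "t > 0" and g: "g \<in> borel_measurable borel"
  shows "(\<integral>\<^sup>+x. g x \<partial>lborel) = ennreal (t powr hdim TYPE('n)) * (\<integral>\<^sup>+x. g (hdil t x) \<partial>lborel)"
proof -
  let ?c = "\<lambda>i :: 'n hidx. case i of Inr (Inr _) \<Rightarrow> t\<^sup>2 | _ \<Rightarrow> t"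
  have "(\<Prod>i\<in>UNIV. ?c i) = t ^ CARD('n) * (t ^ CARD('n) * t\<^sup>2)"
    by (simp flip: UNIV_Plus_UNIV add: prod.Plus UNIV_unit)
  also have "\<dots> = t powr hdim TYPE('n)"
    using powr_realpow[OF t, of "CARD('n) + (CARD('n) + 2)"] 
    by (simp add: hdim_def power_add power2_eq_square mult_ac add.commute)
  finally have "\<bar>\<Prod>i\<in>UNIV. ?c i\<bar> = t powr hdim TYPE('n)" by simp
  moreover have "?c i \<noteq> 0" for i using t by (simp split: sum.split)
  ultimately show ?thesis
    using nn_integral_lborel_diagonal[OF g, of ?c] unfolding hdil_def by simp
qed

section \<open>Power weights\<close>

text \<open>At the origin \<open>0 powr \<beta> = 0\<close> for all \<open>\<beta>\<close>, also for \<open>\<beta> = 0\<close>; this affects a null set only.\<close>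

definition hweight :: "real \<Rightarrow> 'n::finite heis measure" where
  "hweight \<beta> = density lborel (\<lambda>x. ennreal (hnorm x powr \<beta>))"

lemma borel_measurable_hnorm_powr [measurable, simp]:
  "(\<lambda>x. ennreal (hnorm x powr \<beta>)) \<in> borel_measurable lborel"
  by measurable

lemma sets_hweight [measurable_cong, simp]: "sets (hweight \<beta>) = sets borel"
  and space_hweight [simp]: "space (hweight \<beta>) = UNIV"
  by (simp_all add: hweight_def)

lemma measurable_hweight [simp]:
  "measurable (hweight \<beta>) N = measurable borel N"
  by (rule measurable_cong_sets) auto

lemma nn_integral_hweight:
  "g \<in> borel_measurable borel \<Longrightarrow> (\<integral>\<^sup>+x. g x \<partial>hweight \<beta>) = (\<integral>\<^sup>+x. ennreal (hnorm x powr \<beta>) * g x \<partial>lborel)"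
  unfolding hweight_def by (rule nn_integral_density) auto

lemma sigma_finite_hweight: "sigma_finite_measure (hweight \<beta>)"
  unfolding hweight_def by (subst sigma_finite_measure.sigma_finite_iff_density_finite'[OF sigma_finite_lborel]) auto

lemma emeasure_hweight:
  "E \<in> sets borel \<Longrightarrow> emeasure (hweight \<beta>) E = (\<integral>\<^sup>+x. ennreal (hnorm x powr \<beta>) * indicator E x \<partial>lborel)"
  unfolding hweight_def by (rule emeasure_density) auto

lemma AE_lborel_neq_0: "AE x in lborel. x \<noteq> (0 :: 'n::finite heis)"
  by (rule AE_lborel_singleton)

text \<open>The density vanishes only at the origin.\<close>

lemma AE_hweight: "(AE x in hweight \<beta>. P x) \<longleftrightarrow> (AE x in lborel. P x)"
proof -
  have "(AE x in hweight \<beta>. P x) \<longleftrightarrow> (AE x in lborel. x \<noteq> 0 \<longrightarrow> P x)"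
    unfolding hweight_def by (subst AE_density) auto
  also have "\<dots> \<longleftrightarrow> (AE x in lborel. P x)"
    using AE_lborel_neq_0 by (auto elim!: eventually_rev_mp)
  finally show ?thesis .
qed

lemma wmeasure_hweight:
  "E \<in> sets borel \<Longrightarrow> wmeasure (\<lambda>x. hnorm x powr \<beta>) E = emeasure (hweight \<beta>) E"
  unfolding wmeasure_def nn_integral_completion hweight_def
  by (simp add: emeasure_density)

lemma emeasure_hweight_scale:
  fixes E :: "'n::finite heis set"
  assumes E: "E \<in> sets borel" and t: "t > 0"
  shows "emeasure (hweight \<beta>) {x. hdil (1 / t) x \<in> E}
    = ennreal (t powr (hdim TYPE('n) + \<beta>)) * emeasure (hweight \<beta>) E"
proof -
  have [measurable]: "hdil s \<in> borel_measurable borel" for s :: real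
    unfolding hdil_def
    by (intro borel_measurable_vec_lambda borel_measurable_times borel_measurable_const borel_measurable_vec_nth measurable_ident_sets refl)
  note [measurable] = E
  have m: "{x. hdil (1 / t) x \<in> E} \<in> sets borel" by measurable
  have inv: "hdil (1 / t) (hdil t x) = x" for x :: "'n heis"
    using t by (auto simp: hdil_def vec_eq_iff field_simps split: sum.split)
  have "emeasure (hweight \<beta>) {x. hdil (1 / t) x \<in> E}
    = (\<integral>\<^sup>+x. ennreal (hnorm x powr \<beta>) * indicator E (hdil (1 / t) x) \<partial>lborel)"
    using m by (simp add: hweight_def emeasure_density) (intro nn_integral_cong, auto simp: indicator_def)
  also have "\<dots> = ennreal (t powr hdim TYPE('n)) * (\<integral>\<^sup>+x. ennreal (t powr \<beta>) * (ennreal (hnorm x powr \<beta>) * indicator E x) \<partial>lborel)"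
    using t by (subst nn_integral_hdil[OF t], measurable)
      (simp add: inv hnorm_hdil powr_mult ennreal_mult mult_ac)
  also have "\<dots> = ennreal (t powr (hdim TYPE('n) + \<beta>)) * emeasure (hweight \<beta>) E"
    by (simp add: nn_integral_cmult hweight_def emeasure_density powr_add ennreal_mult mult.assoc)
  finally show ?thesis .
qed

lemma emeasure_hweight_scale_hB:
  "emeasure (hweight \<beta>) (hB k :: 'n::finite heis set)
    = ennreal (2 powr (of_int k * (hdim TYPE('n) + \<beta>))) * emeasure (hweight \<beta>) (hB 0 :: 'n heis set)"
  and emeasure_hweight_scale_hE:
  "emeasure (hweight \<beta>) (hE k :: 'n::finite heis set)
    = ennreal (2 powr (of_int k * (hdim TYPE('n) + \<beta>))) * emeasure (hweight \<beta>) (hE 0 :: 'n heis set)"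
proof -
  let ?t = "2 powr real_of_int k"
  have *: "hnorm (hdil (1 / ?t) x) = hnorm x / ?t" for x :: "'n heis" by (simp add: hnorm_hdil)
  have "{x :: 'n heis. hdil (1 / ?t) x \<in> hB 0} = hB k"
    by (simp add: hB_def * powi_2_eq_powr field_simps)
  then show "emeasure (hweight \<beta>) (hB k :: 'n heis set)
    = ennreal (2 powr (of_int k * (hdim TYPE('n) + \<beta>))) * emeasure (hweight \<beta>) (hB 0 :: 'n heis set)"
    using emeasure_hweight_scale[of "hB 0 :: 'n heis set" ?t \<beta>] by (simp add: powr_powr)
  have "{x :: 'n heis. hdil (1 / ?t) x \<in> hE 0} = hE k"
    by (simp add: hE_iff set_eq_iff * field_simps powr_diff)
  then show "emeasure (hweight \<beta>) (hE k :: 'n heis set)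
    = ennreal (2 powr (of_int k * (hdim TYPE('n) + \<beta>))) * emeasure (hweight \<beta>) (hE 0 :: 'n heis set)"
    using emeasure_hweight_scale[of "hE 0 :: 'n heis set" ?t \<beta>] by (simp add: powr_powr)
qed

lemma emeasure_hweight_hE_finite: "emeasure (hweight \<beta>) (hE 0 :: 'n::finite heis set) < \<infinity>"
proof -
  have "bounded (hE 0 :: 'n heis set)"
    by (rule bounded_subset[OF bounded_hnorm_le[of 1]]) (auto simp: hE_iff)
  then have fin: "emeasure lborel (hE 0 :: 'n heis set) < \<infinity>" by (rule emeasure_bounded_finite)
  have "emeasure (hweight \<beta>) (hE 0 :: 'n heis set) \<le> (\<integral>\<^sup>+x\<in>(hE 0 :: 'n heis set). ennreal (2 powr \<bar>\<beta>\<bar>) \<partial>lborel)"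
    unfolding emeasure_hweight[OF sets_hE]
  proof (rule nn_integral_mono)
    fix x :: "'n heis"
    show "ennreal (hnorm x powr \<beta>) * indicator (hE 0) x \<le> ennreal (2 powr \<bar>\<beta>\<bar>) * indicator (hE 0) x"
    proof (cases "x \<in> hE 0")
      case True
      then have x: "1 / 2 \<le> hnorm x" "hnorm x < 1" unfolding hE_iff by (auto simp: powr_minus_divide)
      have "hnorm x powr \<beta> \<le> 2 powr \<bar>\<beta>\<bar>"
      proof (cases "\<beta> \<ge> 0")
        case True
        then have "hnorm x powr \<beta> \<le> 1 powr \<beta>" using x by (intro powr_mono2) auto
        then show ?thesis using True by (simp add: ge_one_powr_ge_zero order_trans[of _ 1])
      next
        case False
        then have "hnorm x powr \<beta> \<le> (1 / 2) powr \<beta>" using x by (intro powr_mono2') auto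
        then show ?thesis using False by (simp add: powr_divide powr_minus_divide)
      qed
      then show ?thesis using True by (simp add: ennreal_leI)
    qed simp
  qed
  also have "\<dots> = ennreal (2 powr \<bar>\<beta>\<bar>) * emeasure lborel (hE 0 :: 'n heis set)"
    by (rule nn_integral_cmult_indicator) simp
  also have "\<dots> < \<infinity>" using fin by (simp add: ennreal_mult_less_top)
  finally show ?thesis .
qed

text \<open>Dilations give the power law.  The constant is finite because \<open>B\<^sub>0\<close> is, up to the origin, the union of the shells
  \<open>E\<^sub>-\<^sub>j\<close>, whose measures form a geometric series of ratio \<open>2\<^sup>-\<^sup>s\<close>, and it is positive because \<open>B\<^sub>0\<close> is open.\<close>

lemma hweight_hB:
  assumes "hdim TYPE('n::finite) + \<beta> > 0"
  obtains c where "c > 0"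
    "\<And>k. wmeasure (\<lambda>x. hnorm x powr \<beta>) (hB k :: 'n heis set) = ennreal (c * 2 powr (of_int k * (hdim TYPE('n) + \<beta>)))"
proof -
  let ?W = "emeasure (hweight \<beta>) (hB 0 :: 'n heis set)" and ?s = "hdim TYPE('n) + \<beta>"
  have "?W \<le> emeasure (hweight \<beta>) (\<Union>j. insert 0 (hE (- int j)) :: 'n heis set)"
  proof (rule emeasure_mono)
    show "hB 0 \<subseteq> (\<Union>j. insert 0 (hE (- int j)) :: 'n heis set)"
    proof
      fix x :: "'n heis" assume x: "x \<in> hB 0"
      show "x \<in> (\<Union>j. insert 0 (hE (- int j)) :: 'n heis set)"
      proof (cases "x = 0")
        case False
        then obtain k where k: "x \<in> hE k" using ex_hE by blast
        then have "2 powr (of_int k - 1) < (2::real) powr 0" using x unfolding hE_iff hB_def by auto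
        then have "k < 1" using powr_less_cancel_iff[of 2 "of_int k - 1" 0] by linarith
        then have "k = - int (nat (- k))" by auto
        then show ?thesis using k by (intro UN_I[of "nat (- k)"]) auto
      qed auto
    qed
  qed auto
  also have "\<dots> \<le> (\<Sum>j. emeasure (hweight \<beta>) (insert 0 (hE (- int j)) :: 'n heis set))"
    by (rule emeasure_subadditive_countably) auto
  also have "\<dots> = (\<Sum>j. ennreal ((2 powr (- ?s)) ^ j) * emeasure (hweight \<beta>) (hE 0 :: 'n heis set))"
  proof (rule suminf_cong)
    fix j
    have "emeasure (hweight \<beta>) (insert 0 (hE (- int j)) :: 'n heis set) = emeasure (hweight \<beta>) (hE (- int j) :: 'n heis set)"
    proof (rule emeasure_eq_AE)
      show "AE x in hweight \<beta>. (x \<in> insert 0 (hE (- int j))) = (x \<in> (hE (- int j) :: 'n heis set))"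
        unfolding AE_hweight using AE_lborel_neq_0 by eventually_elim auto
    qed auto
    also have "\<dots> = ennreal (2 powr (of_int (- int j) * ?s)) * emeasure (hweight \<beta>) (hE 0 :: 'n heis set)"
      by (rule emeasure_hweight_scale_hE)
    also have "2 powr (of_int (- int j) * ?s) = (2 powr (- ?s)) ^ j"
      by (subst powr_realpow[symmetric]) (simp_all only: powr_powr, simp_all add: algebra_simps)
    finally show "emeasure (hweight \<beta>) (insert 0 (hE (- int j)) :: 'n heis set)
      = ennreal ((2 powr (- ?s)) ^ j) * emeasure (hweight \<beta>) (hE 0 :: 'n heis set)" .
  qed
  also have "\<dots> = (\<Sum>j. ennreal ((2 powr (- ?s)) ^ j)) * emeasure (hweight \<beta>) (hE 0 :: 'n heis set)"
    by (rule ennreal_suminf_multc)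
  also have "2 powr (- ?s) < (1::real)" using assms by (simp add: powr_less_one)
  then have "(\<Sum>j. ennreal ((2 powr (- ?s)) ^ j)) = ennreal (1 / (1 - 2 powr (- ?s)))"
    by (intro suminf_ennreal_eq geometric_sums) auto
  also have "ennreal (1 / (1 - 2 powr (- ?s))) * emeasure (hweight \<beta>) (hE 0 :: 'n heis set) < \<infinity>"
    using emeasure_hweight_hE_finite[of \<beta>, where 'n='n] by (simp add: ennreal_mult_less_top)
  finally have fin: "?W < \<infinity>" .
  have "?W \<noteq> 0"
  proof
    assume "?W = 0"
    then have "AE x in hweight \<beta>. x \<notin> (hB 0 :: 'n heis set)"
      by (intro AE_not_in) (auto simp: null_sets_def)
    then have "AE x in lborel. x \<notin> (hB 0 :: 'n heis set)" unfolding AE_hweight .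
    then have "hB 0 \<in> null_sets (lborel :: 'n heis measure)"
      by (subst (asm) AE_iff_null_sets[symmetric]) auto
    then have "negligible (hB 0 :: 'n heis set)"
      by (simp add: negligible_iff_null_sets null_sets_completionI)
    moreover have "open (hB 0 :: 'n heis set)"
      unfolding hB_def by (intro open_Collect_less continuous_on_hnorm continuous_on_const)
    moreover have "0 \<in> (hB 0 :: 'n heis set)" by (simp add: hB_def)
    ultimately show False using open_not_negligible by blast
  qed
  with fin obtain w where w: "?W = ennreal w" "w > 0"
    by (cases ?W) (auto simp: ennreal_eq_0_iff)
  show thesis
  proof (rule that[of w])
    fix k
    show "wmeasure (\<lambda>x. hnorm x powr \<beta>) (hB k :: 'n heis set) = ennreal (w * 2 powr (of_int k * ?s))"
      unfolding wmeasure_hweight[OF sets_hB] emeasure_hweight_scale_hB[of \<beta> k] w(1)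
      using w(2) by (subst mult.commute) (rule ennreal_mult[symmetric], auto)
  qed (rule w(2))
qed

section \<open>Matrices acting on power weights\<close>

lemma hnorm_matrix_le: "ennreal (hnorm (M *v x)) \<le> hmnorm M * ennreal (hnorm x)"
proof (cases "x = 0")
  case False
  then have "ennreal (hnorm (M *v x)) = ennreal (hnorm (M *v x) / hnorm x) * ennreal (hnorm x)"
    by (simp flip: ennreal_mult)
  also have "\<dots> \<le> hmnorm M * ennreal (hnorm x)"
    unfolding hmnorm_def using False by (intro mult_right_mono SUP_upper) auto
  finally show ?thesis .
qed simp

lemma matrix_vector_eq_0_iff: "det (M :: real^'n^'n) \<noteq> 0 \<Longrightarrow> M *v x = 0 \<longleftrightarrow> x = 0"
  by (metis invertible_matrix_inv(4) matrix_vector_mult_0_right)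

lemma hmnorm_neq_0: "det M \<noteq> 0 \<Longrightarrow> hmnorm M \<noteq> 0"
  using hnorm_matrix_le[of M "axis hz 1"] by (auto simp: matrix_vector_eq_0_iff axis_eq_0_iff)

text \<open>The two cases in the definition of \<open>hG\<close> are the two ways to compare \<open>x\<close> with \<open>M x\<close>: an upper bound
  \<open>\<bar>x\<bar> \<le> \<parallel>M'\<parallel> \<bar>M x\<bar>\<close> is needed if \<open>\<beta> > 0\<close>, and a lower bound \<open>\<bar>x\<bar> \<ge> \<bar>M x\<bar> / \<parallel>M\<parallel>\<close> if \<open>\<beta> \<le> 0\<close>.\<close>

lemma hweight_le_matrix:
  assumes M: "det M \<noteq> 0"
  shows "ennreal (hnorm x powr \<beta>) \<le> hG (matrix_inv M) \<beta> * ennreal (hnorm (M *v x) powr \<beta>)"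
proof (cases "x = 0")
  case False
  then have pos: "hnorm x > 0" "hnorm (M *v x) > 0" by (auto simp: matrix_vector_eq_0_iff M)
  show ?thesis
  proof (cases "\<beta> > 0")
    case True
    have "epowr (ennreal (hnorm (matrix_inv M *v (M *v x)))) \<beta> \<le> epowr (hmnorm (matrix_inv M) * ennreal (hnorm (M *v x))) \<beta>"
      using True by (intro epowr_mono hnorm_matrix_le) auto
    then show ?thesis
      using True pos by (simp add: invertible_matrix_inv(4)[OF M] epowr_mult hG_def epowr_ennreal)
  next
    case False
    have "epowr (ennreal (hnorm (M *v x))) (- \<beta>) \<le> epowr (hmnorm M * ennreal (hnorm x)) (- \<beta>)"
      using False by (intro epowr_mono hnorm_matrix_le) auto
    also have "\<dots> = hG (matrix_inv M) \<beta> * epowr (ennreal (hnorm x)) (- \<beta>)"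
      using False by (simp add: epowr_mult hG_def invertible_matrix_inv(5)[OF M])
    finally have *: "ennreal (hnorm (M *v x) powr - \<beta>) \<le> hG (matrix_inv M) \<beta> * ennreal (hnorm x powr - \<beta>)"
      using pos by (simp add: epowr_ennreal_pos)
    let ?c = "ennreal (hnorm x powr \<beta>) * ennreal (hnorm (M *v x) powr \<beta>)"
    have c: "ennreal (hnorm (M *v x) powr - \<beta>) * ?c = ennreal (hnorm x powr \<beta>)"
      "ennreal (hnorm x powr - \<beta>) * ?c = ennreal (hnorm (M *v x) powr \<beta>)"
      using pos by (simp_all add: powr_minus flip: ennreal_mult)
    show ?thesis using mult_right_mono[OF *, of ?c] unfolding mult.assoc c by simp
  qed
qed simp

lemma nn_integral_hweight_matrix:
  assumes M: "det M \<noteq> 0" and [measurable]: "g \<in> borel_measurable borel"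
  shows "(\<integral>\<^sup>+x. g (M *v x) \<partial>hweight \<beta>)
    \<le> ennreal \<bar>det (matrix_inv M)\<bar> * hG (matrix_inv M) \<beta> * (\<integral>\<^sup>+x. g x \<partial>hweight \<beta>)"
proof -
  let ?F = "\<lambda>x. ennreal (hnorm x powr \<beta>) * g x"
  have "(\<integral>\<^sup>+x. ?F (M *v x) \<partial>lborel) = ennreal \<bar>det (matrix_inv M)\<bar> * (ennreal \<bar>det M\<bar> * (\<integral>\<^sup>+x. ?F (M *v x) \<partial>lborel))"
    using M by (simp add: invertible_matrix_inv(6) flip: mult.assoc ennreal_mult)
  also have "ennreal \<bar>det M\<bar> * (\<integral>\<^sup>+x. ?F (M *v x) \<partial>lborel) = (\<integral>\<^sup>+x. ?F x \<partial>lborel)"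
    by (rule nn_integral_lborel_matrix[OF M]) measurable
  finally have *: "(\<integral>\<^sup>+x. ?F (M *v x) \<partial>lborel) = ennreal \<bar>det (matrix_inv M)\<bar> * (\<integral>\<^sup>+x. ?F x \<partial>lborel)" .
  have "(\<integral>\<^sup>+x. g (M *v x) \<partial>hweight \<beta>) = (\<integral>\<^sup>+x. ennreal (hnorm x powr \<beta>) * g (M *v x) \<partial>lborel)"
    by (rule nn_integral_hweight) measurable
  also have "\<dots> \<le> (\<integral>\<^sup>+x. hG (matrix_inv M) \<beta> * ?F (M *v x) \<partial>lborel)"
    unfolding mult.assoc[symmetric] by (intro nn_integral_mono mult_right_mono hweight_le_matrix[OF M]) auto
  also have "\<dots> = hG (matrix_inv M) \<beta> * (\<integral>\<^sup>+x. ?F (M *v x) \<partial>lborel)"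
    by (rule nn_integral_cmult) measurable
  finally show ?thesis unfolding * nn_integral_hweight[OF assms(2)] by (simp add: mult_ac)
qed

lemma epowr_hG: "r > 0 \<Longrightarrow> epowr (hG M \<beta>) (1 / r) = hG M (\<beta> / r)"
  by (auto simp: hG_def epowr_epowr zero_less_divide_iff) (cases "\<beta> = 0", auto simp: epowr_epowr[of "- \<beta>"])

lemma pnorm_hweight_matrix:
  assumes M: "det M \<noteq> 0" and g: "g \<in> borel_measurable borel" and r: "r > 0"
  shows "pnorm (hweight \<beta>) r (\<lambda>x. g (M *v x))
    \<le> ennreal (\<bar>det (matrix_inv M)\<bar> powr (1 / r)) * hG (matrix_inv M) (\<beta> / r) * pnorm (hweight \<beta>) r g"
proof -
  have "pnorm (hweight \<beta>) r (\<lambda>x. g (M *v x))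
    \<le> epowr (ennreal \<bar>det (matrix_inv M)\<bar> * hG (matrix_inv M) \<beta> * (\<integral>\<^sup>+x. epowr (g x) r \<partial>hweight \<beta>)) (1 / r)"
    unfolding pnorm_def using r g
    by (intro epowr_mono nn_integral_hweight_matrix[OF M, of "\<lambda>x. epowr (g x) r"]) auto
  also have "\<dots> = ennreal (\<bar>det (matrix_inv M)\<bar> powr (1 / r)) * hG (matrix_inv M) (\<beta> / r) * pnorm (hweight \<beta>) r g"
    using r by (simp add: epowr_mult epowr_ennreal epowr_hG pnorm_def)
  finally show ?thesis .
qed

section \<open>Shifts of dyadic sequences\<close>

lemma nn_integral_count_space_shift:
  "(\<integral>\<^sup>+k. f (k + m) \<partial>count_space (UNIV :: int set)) = (\<integral>\<^sup>+k. f k \<partial>count_space UNIV)"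
  by (rule nn_integral_bij_count_space) (auto intro!: bij_betw_byWitness[where f' = "\<lambda>k. k - m"])

text \<open>Bounds the norm of the sum of the shifts by \<open>m \<in> I\<close> on sequences with the weights \<open>2\<^sup>k\<^sup>\<sigma>\<close>.\<close>

abbreviation shift_sum :: "real \<Rightarrow> int set \<Rightarrow> ennreal" where
  "shift_sum \<sigma> I \<equiv> \<integral>\<^sup>+m. ennreal (2 powr (- of_int m * \<sigma>)) * indicator I m \<partial>count_space UNIV"

text \<open>The weight satisfies \<open>w k = 2\<^sup>-\<^sup>m\<^sup>\<sigma> w (k + m)\<close>, and the counting measure on the integers is invariant under
  translations.\<close>

lemma pnorm_shift:
  fixes a :: "int \<Rightarrow> ennreal" and c \<sigma> p :: real
  assumes p: "p \<ge> 1" and c: "c > 0"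
  defines "w \<equiv> \<lambda>k::int. ennreal (c * 2 powr (of_int k * \<sigma>))"
  shows "pnorm (count_space UNIV) p (\<lambda>k. w k * (\<integral>\<^sup>+m. indicator I m * a (k + m) \<partial>count_space UNIV))
    \<le> shift_sum \<sigma> I * pnorm (count_space UNIV) p (\<lambda>k. w k * a k)"
proof -
  let ?N = "pnorm (count_space UNIV) p" 
  have w: "w k = ennreal (2 powr (- of_int m * \<sigma>)) * w (k + m)" for k m
    using c unfolding w_def by (simp add: algebra_simps powr_add powr_minus flip: ennreal_mult)
  have "?N (\<lambda>k. w k * (\<integral>\<^sup>+m. indicator I m * a (k + m) \<partial>count_space UNIV))
    = ?N (\<lambda>k. \<integral>\<^sup>+m. ennreal (2 powr (- of_int m * \<sigma>)) * indicator I m * (w (k + m) * a (k + m)) \<partial>count_space UNIV)"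
  proof (rule arg_cong[where f = ?N], rule ext)
    fix k
    have "w k * (\<integral>\<^sup>+m. indicator I m * a (k + m) \<partial>count_space UNIV)
      = (\<integral>\<^sup>+m. w k * (indicator I m * a (k + m)) \<partial>count_space UNIV)"
      by (simp add: nn_integral_cmult)
    also have "\<dots> = (\<integral>\<^sup>+m. ennreal (2 powr (- of_int m * \<sigma>)) * indicator I m * (w (k + m) * a (k + m)) \<partial>count_space UNIV)"
      by (rule nn_integral_cong, subst w) (simp only: mult_ac)
    finally show "w k * (\<integral>\<^sup>+m. indicator I m * a (k + m) \<partial>count_space UNIV) = \<dots>" .
  qed
  also have "\<dots> \<le> (\<integral>\<^sup>+m. ?N (\<lambda>k. ennreal (2 powr (- of_int m * \<sigma>)) * indicator I m * (w (k + m) * a (k + m))) \<partial>count_space UNIV)"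
    by (rule pnorm_nn_integral_count_space[OF p]) (auto intro: sigma_finite_measure_count_space_countable)
  also have "\<dots> = (\<integral>\<^sup>+m. ennreal (2 powr (- of_int m * \<sigma>)) * indicator I m * ?N (\<lambda>k. w k * a k) \<partial>count_space UNIV)"
    using p nn_integral_count_space_shift[of "\<lambda>k. epowr (w k * a k) p"]
    by (intro nn_integral_cong) (simp add: pnorm_cmult pnorm_def[of _ _ "\<lambda>k. w (k + _) * a (k + _)"] pnorm_def[of _ _ "\<lambda>k. w k * a k"])
  also have "\<dots> = shift_sum \<sigma> I * ?N (\<lambda>k. w k * a k)" by (rule nn_integral_multc) simp
  finally show ?thesis .
qed

lemma shift_sum_atLeast:
  assumes "\<sigma> > 0" shows "shift_sum \<sigma> {l..} = ennreal (2 powr (- of_int l * \<sigma>) / (1 - 2 powr (- \<sigma>)))"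
proof -
  have "shift_sum \<sigma> {l..} = (\<integral>\<^sup>+m. ennreal (2 powr (- of_int m * \<sigma>)) \<partial>count_space {l..})"
    by (rule nn_integral_count_space_indicator[symmetric]) simp
  also have "\<dots> = (\<integral>\<^sup>+n. ennreal (2 powr (- of_int (l + int n) * \<sigma>)) \<partial>count_space UNIV)"
    by (rule nn_integral_bij_count_space[symmetric])
      (auto intro!: bij_betw_byWitness[where f' = "\<lambda>m. nat (m - l)"])
  also have "\<dots> = (\<Sum>n. ennreal (2 powr (- of_int l * \<sigma>) * (2 powr (- \<sigma>)) ^ n))"
    unfolding nn_integral_count_space_nat
    by (intro suminf_cong arg_cong[where f = ennreal]) (simp add: powr_power powr_add[symmetric] algebra_simps)
  also have "\<dots> = ennreal (2 powr (- of_int l * \<sigma>) * (1 / (1 - 2 powr (- \<sigma>))))"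
    using assms by (intro suminf_ennreal_eq sums_mult geometric_sums) (auto simp: powr_less_one)
  finally show ?thesis by simp
qed

lemma shift_sum_atMost:
  assumes "\<sigma> < 0" shows "shift_sum \<sigma> {..l} = ennreal (2 powr (- of_int l * \<sigma>) / (1 - 2 powr \<sigma>))"
proof -
  have "shift_sum \<sigma> {..l} = (\<integral>\<^sup>+m. ennreal (2 powr (- of_int (- m) * \<sigma>)) * indicator {..l} (- m) \<partial>count_space UNIV)"
    by (rule nn_integral_bij_count_space[symmetric]) (auto intro!: bij_betw_byWitness[where f' = uminus])
  also have "\<dots> = shift_sum (- \<sigma>) {- l..}"
    by (intro nn_integral_cong) (auto simp: indicator_def)
  finally show ?thesis using shift_sum_atLeast[of "- \<sigma>" "- l"] assms by simp
qed

lemma powr_le1_neg: "x \<le> 0 \<Longrightarrow> 2 powr x \<le> (1::real)"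
  using powr_mono[of x 0 2] by simp

lemma hmnorm_eq_ennreal:
  assumes "det M \<noteq> 0" "hmnorm M \<noteq> \<infinity>"
  obtains m where "m > 0" "hmnorm M = ennreal m"
  using assms hmnorm_neq_0[of M] by (cases "hmnorm M") (auto simp: ennreal_eq_0_iff)

lemma hnorm_matrix_le_real:
  assumes "hmnorm M = ennreal m" "m > 0" shows "hnorm (M *v x) \<le> m * hnorm x"
  using hnorm_matrix_le[of M x] assms by (simp flip: ennreal_mult)

lemma hE_matrix_index_le:
  assumes m: "hmnorm M = ennreal m" "m > 0" and x: "x \<in> hE k" "M *v x \<in> hE (k + j)"
  shows "j \<le> \<lfloor>1 + log 2 m\<rfloor>"
proof -
  have "2 powr (of_int (k + j) - 1) \<le> hnorm (M *v x)" using x(2) unfolding hE_iff by simp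
  also have "\<dots> \<le> m * hnorm x" by (rule hnorm_matrix_le_real[OF m])
  also have "\<dots> < m * 2 powr of_int k" using x(1) m(2) unfolding hE_iff by simp
  finally have "2 powr of_int k * 2 powr (of_int j - 1) < 2 powr of_int k * m"
    by (simp add: mult.commute add_diff_eq flip: powr_add)
  then have "2 powr (of_int j - 1) < m" by simp
  then have "of_int j - 1 < log 2 m" using m(2) by (simp add: less_log_iff)
  then show ?thesis by linarith
qed

text \<open>Apply the upper bound to the inverse matrix.\<close>

lemma hE_matrix_index_ge:
  assumes M: "det M \<noteq> 0" and m: "hmnorm (matrix_inv M) = ennreal m" "m > 0"
    and x: "x \<in> hE k" "M *v x \<in> hE (k + j)"
  shows "- \<lfloor>1 + log 2 m\<rfloor> \<le> j"
  using hE_matrix_index_le[OF m x(2), of "- j"] x(1) by (simp add: invertible_matrix_inv[OF M])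

lemma one_le_hmnorm_mult:
  assumes M: "det M \<noteq> 0" and m: "hmnorm M = ennreal m" "m > 0"
    and m': "hmnorm (matrix_inv M) = ennreal m'" "m' > 0"
  shows "1 \<le> m' * m"
proof -
  let ?x = "axis hz 1 :: 'a heis"
  have x: "hnorm ?x > 0" by (simp add: axis_eq_0_iff)
  have "hnorm ?x \<le> m' * hnorm (M *v ?x)"
    using hnorm_matrix_le_real[OF m', of "M *v ?x"] by (simp add: invertible_matrix_inv[OF M])
  also have "\<dots> \<le> m' * (m * hnorm ?x)" using m'(2) hnorm_matrix_le_real[OF m, of ?x] by simp
  finally show ?thesis using x by simp
qed

text \<open>In the geometric cases the numerator absorbs the factors \<open>2\<close> at the two ends of the window of indices.\<close>

definition shift_const :: "real \<Rightarrow> real" where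
  "shift_const \<sigma> = (if \<sigma> = 0 then 3 else 2 powr \<bar>\<sigma>\<bar> / (1 - 2 powr (- \<bar>\<sigma>\<bar>)))"

lemma shift_const_pos: "shift_const \<sigma> > 0"
proof -
  have "\<sigma> \<noteq> 0 \<Longrightarrow> 2 powr (- \<bar>\<sigma>\<bar>) < (1::real)" by (simp add: powr_less_one)
  then show ?thesis by (simp add: shift_const_def)
qed

text \<open>Only the end of the window where \<open>2\<^sup>-\<^sup>m\<^sup>\<sigma>\<close> is large matters if \<open>\<sigma> \<noteq> 0\<close>; the set \<open>I\<close> is then chosen as a half-line.
  If the bound is infinite, all integers are admitted.\<close>

lemma shift_sum_indices_bound:
  fixes M :: "'n::finite hmat"
  assumes M: "det M \<noteq> 0"
  obtains I where "\<And>k m x. x \<in> hE k \<Longrightarrow> M *v x \<in> hE (k + m) \<Longrightarrow> m \<in> I"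
    and "shift_sum \<sigma> I \<le> ennreal (shift_const \<sigma>) *
      (if \<sigma> = 0 then 1 + elog 2 (hmnorm (matrix_inv M) * hmnorm M) else hG (matrix_inv M) \<sigma>)"
proof -
  let ?K = "if \<sigma> = 0 then 1 + elog 2 (hmnorm (matrix_inv M) * hmnorm M) else hG (matrix_inv M) \<sigma>"
  show thesis
  proof (cases "?K = \<infinity>")
    case True
    have "ennreal (shift_const \<sigma>) * ?K = \<infinity>"
      unfolding True using shift_const_pos[of \<sigma>] by (simp add: ennreal_mult_top)
    then show thesis by (intro that[of UNIV]) auto
  next
    case fin: False
    have M': "det (matrix_inv M) \<noteq> 0" using M by (simp add: invertible_matrix_inv)
    consider "\<sigma> > 0" | "\<sigma> < 0" | "\<sigma> = 0" by linarith
    then show thesis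
    proof cases
      case 1
      then have "hmnorm (matrix_inv M) \<noteq> \<infinity>" using fin by (auto simp: hG_def)
      then obtain m where m: "m > 0" "hmnorm (matrix_inv M) = ennreal m" using hmnorm_eq_ennreal[OF M'] by metis
      let ?l = "- \<lfloor>1 + log 2 m\<rfloor>"
      have "2 powr (- of_int ?l * \<sigma>) \<le> 2 powr ((1 + log 2 m) * \<sigma>)"
        using 1 by (intro powr_mono mult_right_mono) auto
      also have "\<dots> = 2 powr \<sigma> * m powr \<sigma>"
        using m(1) by (simp add: distrib_right powr_add flip: powr_powr)
      finally have "2 powr (- of_int ?l * \<sigma>) / (1 - 2 powr (- \<sigma>)) \<le> 2 powr \<sigma> * m powr \<sigma> / (1 - 2 powr (- \<sigma>))"
        using 1 by (intro divide_right_mono) (auto intro: powr_le1_neg)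
      also have "\<dots> = shift_const \<sigma> * m powr \<sigma>" using 1 by (simp add: shift_const_def)
      finally have "shift_sum \<sigma> {?l..} \<le> ennreal (shift_const \<sigma>) * ?K"
        unfolding shift_sum_atLeast[OF 1] using 1 m less_imp_le[OF shift_const_pos[of \<sigma>]]
        by (simp add: hG_def epowr_ennreal flip: ennreal_mult)
      then show thesis by (intro that[of "{?l..}"]) (use hE_matrix_index_ge[OF M m(2,1)] in auto)
    next
      case 2
      then have "hmnorm M \<noteq> \<infinity>" using fin by (auto simp: hG_def invertible_matrix_inv(5)[OF M])
      then obtain m where m: "m > 0" "hmnorm M = ennreal m" using hmnorm_eq_ennreal[OF M] by metis
      let ?l = "\<lfloor>1 + log 2 m\<rfloor>"
      have "of_int ?l * - \<sigma> \<le> (1 + log 2 m) * - \<sigma>"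
        using 2 by (intro mult_right_mono) auto
      then have "2 powr (- of_int ?l * \<sigma>) \<le> 2 powr ((1 + log 2 m) * - \<sigma>)"
        by (intro powr_mono) (simp_all only: mult_minus_left mult_minus_right one_le_numeral)
      also have "\<dots> = 2 powr (- \<sigma>) * m powr (- \<sigma>)"
        using m(1) by (simp only: distrib_right powr_add powr_powr[symmetric]) simp
      finally have "2 powr (- of_int ?l * \<sigma>) / (1 - 2 powr \<sigma>) \<le> 2 powr (- \<sigma>) * m powr (- \<sigma>) / (1 - 2 powr \<sigma>)"
        using 2 by (intro divide_right_mono) (auto intro: powr_le1_neg)
      also have "\<dots> = shift_const \<sigma> * m powr (- \<sigma>)" using 2 by (simp add: shift_const_def)
      finally have "shift_sum \<sigma> {..?l} \<le> ennreal (shift_const \<sigma>) * ?K"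
        unfolding shift_sum_atMost[OF 2] using 2 m less_imp_le[OF shift_const_pos[of \<sigma>]]
        by (simp add: hG_def epowr_ennreal invertible_matrix_inv(5)[OF M] flip: ennreal_mult)
      then show thesis by (intro that[of "{..?l}"]) (use hE_matrix_index_le[OF m(2,1)] in auto)
    next
      case 3
      then have "hmnorm (matrix_inv M) * hmnorm M \<noteq> \<infinity>" using fin by (auto simp: elog_def)
      then have "hmnorm M \<noteq> \<infinity>" "hmnorm (matrix_inv M) \<noteq> \<infinity>"
        using hmnorm_neq_0[OF M] hmnorm_neq_0[OF M'] by (auto simp: ennreal_mult_eq_top_iff)
      then obtain m m' where m: "m > 0" "hmnorm M = ennreal m" and m': "m' > 0" "hmnorm (matrix_inv M) = ennreal m'"
        using hmnorm_eq_ennreal[OF M] hmnorm_eq_ennreal[OF M'] by metis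
      let ?l = "- \<lfloor>1 + log 2 m'\<rfloor>" and ?u = "\<lfloor>1 + log 2 m\<rfloor>"
      have ge: "log 2 (m' * m) \<ge> 0" using one_le_hmnorm_mult[OF M m(2,1) m'(2,1)] by simp
      have log: "log 2 (m' * m) = log 2 m' + log 2 m" using m(1) m'(1) by (simp add: log_mult)
      have K: "?K = 1 + ennreal (log 2 (m' * m))"
        using 3 m m' by (simp add: elog_def ennreal_mult_eq_top_iff enn2real_mult)
      have "shift_sum \<sigma> {?l..?u} = emeasure (count_space UNIV) {?l..?u}"
        using 3 by simp
      also have "\<dots> = ennreal (real (card {?l..?u}))"
        by (subst emeasure_count_space_finite) (auto simp: ennreal_of_nat_eq_real_of_nat)
      also have "real (card {?l..?u}) \<le> 3 * (1 + log 2 (m' * m))"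
        using ge unfolding log by (simp add: of_nat_nat) linarith
      also have "ennreal (3 * (1 + log 2 (m' * m))) = ennreal (shift_const \<sigma>) * ?K"
        unfolding K using 3 ge by (simp add: shift_const_def ennreal_mult ennreal_plus)
      finally have "shift_sum \<sigma> {?l..?u} \<le> ennreal (shift_const \<sigma>) * ?K" by (simp add: ennreal_leI)
      then show thesis
        by (intro that[of "{?l..?u}"]) (use hE_matrix_index_le[OF m(2,1)] hE_matrix_index_ge[OF M m'(2,1)] in auto)
    qed
  qed
qed

text \<open>For \<open>x\<close> in \<open>E\<^sub>k\<close>, the point \<open>M x\<close> lies in exactly one shell \<open>E\<^sub>k\<^sub>+\<^sub>m\<close>, and \<open>m\<close> belongs to \<open>I\<close>.\<close>

lemma pnorm_hE_matrix_le:
  fixes M :: "'n::finite hmat" and f :: "'n heis \<Rightarrow> ennreal"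
  assumes M: "det M \<noteq> 0" and [measurable]: "f \<in> borel_measurable borel" and r: "r \<ge> 1"
    and I: "\<And>m x. x \<in> hE k \<Longrightarrow> M *v x \<in> hE (k + m) \<Longrightarrow> m \<in> I"
  shows "pnorm (hweight \<beta>) r (\<lambda>x. f (M *v x) * indicator (hE k) x)
    \<le> ennreal (\<bar>det (matrix_inv M)\<bar> powr (1 / r)) * hG (matrix_inv M) (\<beta> / r)
      * (\<integral>\<^sup>+m. indicator I m * pnorm (hweight \<beta>) r (\<lambda>x. f x * indicator (hE (k + m)) x) \<partial>count_space UNIV)"
proof -
  let ?c = "ennreal (\<bar>det (matrix_inv M)\<bar> powr (1 / r)) * hG (matrix_inv M) (\<beta> / r)"
  let ?g = "\<lambda>m x. indicator I m * (f x * indicator (hE (k + m)) x)"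
  have meas [measurable]: "?g m \<in> borel_measurable borel" for m by measurable
  have "AE x in hweight \<beta>. f (M *v x) * indicator (hE k) x \<le> (\<integral>\<^sup>+m. ?g m (M *v x) \<partial>count_space UNIV)"
    unfolding AE_hweight using AE_lborel_neq_0
  proof eventually_elim
    case (elim x)
    then have "M *v x \<noteq> 0" by (simp add: matrix_vector_eq_0_iff M)
    then obtain l where l: "M *v x \<in> hE l" using ex_hE by blast
    show ?case
    proof (cases "x \<in> hE k")
      case True
      then have "f (M *v x) * indicator (hE k) x \<le> ?g (l - k) (M *v x)" using I[of x "l - k"] l by simp
      also have "\<dots> \<le> (\<integral>\<^sup>+m. ?g m (M *v x) \<partial>count_space UNIV)"
        by (rule nn_integral_ge_point) simp
      finally show ?thesis .
    qed simp
  qed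
  then have "pnorm (hweight \<beta>) r (\<lambda>x. f (M *v x) * indicator (hE k) x)
      \<le> pnorm (hweight \<beta>) r (\<lambda>x. \<integral>\<^sup>+m. ?g m (M *v x) \<partial>count_space UNIV)"
    using r by (intro pnorm_mono_AE) auto
  also have "\<dots> \<le> (\<integral>\<^sup>+m. pnorm (hweight \<beta>) r (\<lambda>x. ?g m (M *v x)) \<partial>count_space UNIV)"
    by (rule pnorm_nn_integral_count_space[OF r sigma_finite_hweight]) auto
  also have "\<dots> \<le> (\<integral>\<^sup>+m. ?c * (indicator I m * pnorm (hweight \<beta>) r (\<lambda>x. f x * indicator (hE (k + m)) x)) \<partial>count_space UNIV)"
  proof (rule nn_integral_mono)
    fix m
    have "pnorm (hweight \<beta>) r (\<lambda>x. ?g m (M *v x)) \<le> ?c * pnorm (hweight \<beta>) r (?g m)"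
      using r by (intro pnorm_hweight_matrix[OF M meas]) auto
    also have "pnorm (hweight \<beta>) r (?g m) = indicator I m * pnorm (hweight \<beta>) r (\<lambda>x. f x * indicator (hE (k + m)) x)"
      using r by (intro pnorm_cmult) auto
    finally show "pnorm (hweight \<beta>) r (\<lambda>x. ?g m (M *v x))
      \<le> ?c * (indicator I m * pnorm (hweight \<beta>) r (\<lambda>x. f x * indicator (hE (k + m)) x))" .
  qed
  also have "\<dots> = ?c * (\<integral>\<^sup>+m. indicator I m * pnorm (hweight \<beta>) r (\<lambda>x. f x * indicator (hE (k + m)) x) \<partial>count_space UNIV)"
    by (rule nn_integral_cmult) simp
  finally show ?thesis .
qed

section \<open>Central mean oscillation\<close>

lemma epowr_real_mult_powr:
  "c > 0 \<Longrightarrow> epowr (ennreal (c * 2 powr x)) a = ennreal (c powr a * 2 powr (x * a))"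
  by (simp add: epowr_ennreal_pos powr_mult powr_powr)

text \<open>The cost of one dyadic step between averages and of the rounding of \<open>log\<^sub>2 \<parallel>M\<parallel>\<close>, with \<open>a = (Q + \<beta>) / q\<close>.  The
  division by \<open>ln 2\<close> makes the constant \<open>1\<close> dominated by the logarithmic factor of \<open>Theta\<close>, which is at least
  \<open>ln 2\<close>.\<close>

definition osc_const :: "real \<Rightarrow> real" where
  "osc_const a = (2 + 2 * 2 powr a) / ln 2"

lemma osc_const_pos: "osc_const a > 0"
  by (simp add: osc_const_def add_pos_pos)

text \<open>A function whose weighted oscillation on each dyadic ball, about some constant \<open>c k\<close>, is at most \<open>N\<close>.  The
  oscillation bound \<open>N\<close> is positive, so that a product with an infinite matrix norm is infinite; the case of
  vanishing oscillation is recovered by a limit.\<close>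

locale central_oscillation =
  fixes q \<beta> s c0 N :: real and b :: "'n::finite heis \<Rightarrow> complex" and c :: "int \<Rightarrow> complex" and u :: "int \<Rightarrow> ennreal"
  assumes q: "q > 1" and s: "s = hdim TYPE('n) + \<beta>" "s > 0" and c0: "c0 > 0" and N: "N > 0"
    and b: "b \<in> borel_measurable borel"
    and vol: "\<And>k. emeasure (hweight \<beta>) (hB k :: 'n heis set) = ennreal (c0 * 2 powr (of_int k * s))"
    and u: "\<And>k. u k = epowr (emeasure (hweight \<beta>) (hB k :: 'n heis set)) (1 / q)"
    and osc: "\<And>k. pnorm (hweight \<beta>) q (\<lambda>x. ennreal (norm (b x - c k)) * indicator (hB k) x) \<le> ennreal N * u k"
begin

lemma u_eq: "u k = ennreal (c0 powr (1 / q) * 2 powr (of_int k * (s / q)))"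
  unfolding u vol epowr_real_mult_powr[OF c0] by simp

lemma u_add: "u (k + j) = ennreal (2 powr (of_int j * (s / q))) * u k"
  unfolding u_eq of_int_add distrib_right powr_add by (simp add: ennreal_mult mult_ac)

lemma u_pos: "u k \<noteq> 0" "u k \<noteq> \<infinity>"
  unfolding u_eq using c0 by (auto simp: ennreal_eq_0_iff not_le)

lemma measurable_osc [measurable]: "(\<lambda>x. ennreal (norm (b x - d)) * indicator (hB k) x) \<in> borel_measurable borel"
  using b by measurable

lemma pnorm_const: "pnorm (hweight \<beta>) q (\<lambda>x. r * indicator (hB k :: 'n heis set) x) = r * u k"
  unfolding u using q by (intro pnorm_indicator) auto

lemma hB_mono: "k \<le> l \<Longrightarrow> hB k \<subseteq> (hB l :: 'n heis set)"
  using powr_mono[of "of_int k" "of_int l" "2::real"] by (auto simp: hB_def powi_2_eq_powr intro: less_le_trans)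

text \<open>On \<open>B\<^sub>k\<close> the constant \<open>c (k + 1) - c k\<close> is the difference of \<open>b - c k\<close> and \<open>b - c (k + 1)\<close>, and the measures of
  \<open>B\<^sub>k\<close> and \<open>B\<^sub>k\<^sub>+\<^sub>1\<close> are comparable.\<close>

lemma consecutive_averages: "norm (c (k + 1) - c k) \<le> N * (1 + 2 powr (s / q))"
proof -
  let ?p = "pnorm (hweight \<beta>) q"
  let ?d = "\<lambda>l x. ennreal (norm (b x - c l)) * indicator (hB l) x"
  have "ennreal (norm (c (k + 1) - c k)) * u k = ?p (\<lambda>x. ennreal (norm (c (k + 1) - c k)) * indicator (hB k :: 'n heis set) x)"
    by (rule pnorm_const[symmetric])
  also have "\<dots> \<le> ?p (\<lambda>x. ?d k x + ?d (k + 1) x)"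
  proof (rule pnorm_mono_AE)
    have "ennreal (norm (c (k + 1) - c k)) * indicator (hB k) x \<le> ?d k x + ?d (k + 1) x" for x
    proof (cases "x \<in> hB k")
      case True
      have "c (k + 1) - c k = (b x - c k) - (b x - c (k + 1))" by simp
      then have "norm (c (k + 1) - c k) \<le> norm (b x - c k) + norm (b x - c (k + 1))"
        using norm_triangle_ineq4 by metis
      then show ?thesis using True hB_mono[of k "k + 1"] by (auto simp flip: ennreal_plus)
    qed simp
    then show "AE x in hweight \<beta>. ennreal (norm (c (k + 1) - c k)) * indicator (hB k) x \<le> ?d k x + ?d (k + 1) x"
      by simp
  qed (use q in simp)
  also have "\<dots> \<le> ?p (?d k) + ?p (?d (k + 1))"
    using q by (intro pnorm_add sigma_finite_hweight) auto
  also have "\<dots> \<le> ennreal N * u k + ennreal N * u (k + 1)" by (intro add_mono osc)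
  also have "\<dots> = ennreal (N * (1 + 2 powr (s / q))) * u k"
    unfolding u_add[of k 1] using N by (simp add: ennreal_mult ennreal_plus distrib_left distrib_right mult_ac)
  finally have "ennreal (norm (c (k + 1) - c k)) \<le> ennreal (N * (1 + 2 powr (s / q)))"
    using u_pos[of k] by (simp add: ennreal_mult_le_mult_iff mult.commute[of _ "u k"] less_top)
  then show ?thesis using N by (simp add: add_nonneg_nonneg)
qed

lemma distant_averages: "norm (c (k + j) - c k) \<le> \<bar>of_int j\<bar> * (N * (1 + 2 powr (s / q)))"
proof -
  let ?C = "N * (1 + 2 powr (s / q))"
  have *: "norm (c (k + int n) - c k) \<le> real n * ?C" for k n
  proof (induction n)
    case (Suc n)
    have "c (k + int (Suc n)) - c k = (c (k + int n + 1) - c (k + int n)) + (c (k + int n) - c k)"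
      by (simp add: add_ac)
    then have "norm (c (k + int (Suc n)) - c k) \<le> norm (c (k + int n + 1) - c (k + int n)) + norm (c (k + int n) - c k)"
      using norm_triangle_ineq by metis
    also have "\<dots> \<le> ?C + real n * ?C" by (intro add_mono Suc consecutive_averages)
    finally show ?case by (simp add: algebra_simps)
  qed simp
  show ?thesis
  proof (cases "j \<ge> 0")
    case True
    then show ?thesis using *[of k "nat j"] by simp
  next
    case False
    then show ?thesis using *[of "k + j" "nat (- j)"] by (simp add: norm_minus_commute)
  qed
qed

text \<open>The comparison of \<open>b x\<close> with \<open>b (M x)\<close> goes through the constants attached to \<open>B\<^sub>k\<close> and to the ball \<open>B\<^sub>k\<^sub>+\<^sub>j\<close>
  that contains the image of \<open>B\<^sub>k\<close>.\<close>

lemma pnorm_difference_le: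
  fixes M :: "'n hmat"
  assumes M: "det M \<noteq> 0"
  defines "m \<equiv> hmnorm M"
  shows "pnorm (hweight \<beta>) q (\<lambda>x. ennreal (norm (b x - b (M *v x))) * indicator (hB k) x)
    \<le> ennreal (osc_const (s / q) * N) * (if m < 1 then elog (exp 1) (2 / m) else elog (exp 1) (2 * m))
      * (1 + ennreal (\<bar>det (matrix_inv M)\<bar> powr (1 / q)) * hG (matrix_inv M) (\<beta> / q) * epowr m (s / q)) * u k"
proof -
  let ?L = "if m < 1 then elog (exp 1) (2 / m) else elog (exp 1) (2 * m)"
  let ?D = "ennreal (\<bar>det (matrix_inv M)\<bar> powr (1 / q)) * hG (matrix_inv M) (\<beta> / q)"
  show ?thesis
  proof (cases "m = \<infinity>")
    case True
    then have "?L = \<infinity>" by (simp add: elog_def ennreal_mult_top)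
    moreover have "osc_const (s / q) * N > 0" using osc_const_pos N by simp
    ultimately show ?thesis using u_pos[of k] by (simp add: ennreal_mult_top ennreal_top_mult ennreal_mult_eq_top_iff ennreal_eq_0_iff not_le)
  next
    case False
    then obtain r where r: "r > 0" "hmnorm M = ennreal r" unfolding m_def by (rule hmnorm_eq_ennreal[OF M])
    \<comment> \<open>The least \<open>j\<close> with \<open>\<parallel>M\<parallel> \<le> 2\<^sup>j\<close>.\<close>
    define j where "j = \<lceil>log 2 r\<rceil>"
    let ?p = "pnorm (hweight \<beta>) q"
    let ?d = "\<lambda>l x. ennreal (norm (b x - c l)) * indicator (hB l) x"
    let ?C = "1 + 2 powr (s / q)"
    \<comment> \<open>Both branches of the logarithmic factor of \<open>Theta\<close> equal \<open>l\<close>.\<close>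
    define l where "l = ln 2 + \<bar>ln r\<bar>"
    have l: "l \<ge> ln 2" "l > 0" by (auto simp: l_def add_pos_nonneg)
    have L: "?L = ennreal l"
    proof (cases "r < 1")
      case True
      have "2 / ennreal r = ennreal (2 / r)" using r(1) by (simp add: divide_ennreal flip: ennreal_numeral)
      then show ?thesis using True r
        by (simp add: m_def elog_def log_def ln_div l_def)
    next
      case False
      have "2 * ennreal r = ennreal (2 * r)" using r(1) by (simp add: ennreal_mult)
      then show ?thesis using False r
        by (simp add: m_def elog_def log_def ln_mult l_def del: ennreal_mult)
    qed
    have jle: "\<bar>of_int j\<bar> \<le> l / ln 2"
    proof -
      have "\<bar>of_int j\<bar> \<le> 1 + \<bar>log 2 r\<bar>" unfolding j_def by linarith
      also have "\<dots> = l / ln 2" by (simp add: l_def log_def add_divide_distrib abs_divide)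
      finally show ?thesis .
    qed
    have in_ball: "M *v x \<in> hB (k + j)" if "x \<in> hB k" for x
    proof -
      have "hnorm (M *v x) \<le> r * hnorm x" by (rule hnorm_matrix_le_real[OF r(2,1)])
      also have "\<dots> < r * 2 powr of_int k" using that r(1) by (simp add: hB_def powi_2_eq_powr)
      also have "r = 2 powr log 2 r" using r(1) by simp
      also have "\<dots> \<le> 2 powr of_int j" unfolding j_def by (intro powr_mono) auto
      finally show ?thesis by (simp add: hB_def powi_2_eq_powr powr_add mult.commute)
    qed
    have u_far: "u (k + j) \<le> ennreal (2 powr (s / q) * r powr (s / q)) * u k"
    proof -
      have "of_int j * (s / q) \<le> (1 + log 2 r) * (s / q)"
        unfolding j_def using s(2) q by (intro mult_right_mono) (auto intro: less_imp_le divide_pos_pos, linarith)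
      then have "2 powr (of_int j * (s / q)) \<le> 2 powr ((1 + log 2 r) * (s / q))" by (rule powr_mono) simp
      also have "\<dots> = 2 powr (s / q) * r powr (s / q)"
        using r(1) by (simp only: distrib_right powr_add powr_powr[symmetric]) simp
      finally show ?thesis unfolding u_add by (intro mult_right_mono ennreal_leI) auto
    qed
    have meas: "(\<lambda>x. ?d (k + j) (M *v x)) \<in> borel_measurable borel"
      by (rule measurable_compose[OF borel_measurable_matrix_vector_mult measurable_osc])
    have "?p (\<lambda>x. ennreal (norm (b x - b (M *v x))) * indicator (hB k) x)
      \<le> ?p (\<lambda>x. ?d k x + (ennreal (norm (c (k + j) - c k)) * indicator (hB k) x + ?d (k + j) (M *v x)))"
    proof (rule pnorm_mono_AE)
      have "ennreal (norm (b x - b (M *v x))) * indicator (hB k) x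
        \<le> ?d k x + (ennreal (norm (c (k + j) - c k)) * indicator (hB k) x + ?d (k + j) (M *v x))" for x
      proof (cases "x \<in> hB k")
        case True
        let ?w = "(c (k + j) - c k) + (b (M *v x) - c (k + j))"
        have "b x - b (M *v x) = (b x - c k) - ?w" by simp
        then have "norm (b x - b (M *v x)) \<le> norm (b x - c k) + norm ?w"
          using norm_triangle_ineq4[of "b x - c k" ?w] by simp
        also have "\<dots> \<le> norm (b x - c k) + (norm (c (k + j) - c k) + norm (b (M *v x) - c (k + j)))"
          by (intro add_left_mono norm_triangle_ineq)
        finally have "norm (b x - b (M *v x)) \<le> norm (b x - c k) + (norm (c (k + j) - c k) + norm (b (M *v x) - c (k + j)))" .
        then show ?thesis using True in_ball[OF True] by (simp flip: ennreal_plus)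
      qed simp
      then show "AE x in hweight \<beta>. ennreal (norm (b x - b (M *v x))) * indicator (hB k) x
        \<le> ?d k x + (ennreal (norm (c (k + j) - c k)) * indicator (hB k) x + ?d (k + j) (M *v x))" by simp
    qed (use q in simp)
    also have "\<dots> \<le> ?p (?d k) + ?p (\<lambda>x. ennreal (norm (c (k + j) - c k)) * indicator (hB k) x + ?d (k + j) (M *v x))"
      using q meas by (intro pnorm_add sigma_finite_hweight) auto
    also have "\<dots> \<le> ?p (?d k) + (?p (\<lambda>x. ennreal (norm (c (k + j) - c k)) * indicator (hB k :: 'n heis set) x) + ?p (\<lambda>x. ?d (k + j) (M *v x)))"
      using q meas by (intro add_left_mono pnorm_add sigma_finite_hweight) auto
    also have "\<dots> \<le> ennreal N * u k + (ennreal (\<bar>of_int j\<bar> * (N * ?C)) * u k + ?D * (ennreal N * u (k + j)))"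
    proof (intro add_mono osc)
      show "?p (\<lambda>x. ennreal (norm (c (k + j) - c k)) * indicator (hB k :: 'n heis set) x) \<le> ennreal (\<bar>of_int j\<bar> * (N * ?C)) * u k"
        unfolding pnorm_const by (intro mult_right_mono ennreal_leI distant_averages) simp
      have "?p (\<lambda>x. ?d (k + j) (M *v x)) \<le> ?D * ?p (?d (k + j))"
        using q by (intro pnorm_hweight_matrix[OF M]) auto
      also have "\<dots> \<le> ?D * (ennreal N * u (k + j))" by (intro mult_left_mono osc) simp
      finally show "?p (\<lambda>x. ?d (k + j) (M *v x)) \<le> ?D * (ennreal N * u (k + j))" .
    qed
    also have "\<dots> \<le> ennreal N * u k + (ennreal (\<bar>of_int j\<bar> * (N * ?C)) * u k + ?D * (ennreal N * (ennreal (2 powr (s / q) * r powr (s / q)) * u k)))"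
      by (intro add_left_mono mult_left_mono u_far) auto
    also have "\<dots>
      = (ennreal (N * (1 + \<bar>of_int j\<bar> * ?C)) + ennreal (N * 2 powr (s / q)) * (?D * ennreal (r powr (s / q)))) * u k"
      using N by (simp add: ennreal_mult ennreal_plus distrib_left distrib_right mult_ac)
    also have "\<dots> \<le> (ennreal (osc_const (s / q) * N * l) + ennreal (osc_const (s / q) * N * l) * (?D * ennreal (r powr (s / q)))) * u k"
    proof (intro mult_right_mono add_mono ennreal_leI)
      have one: "1 \<le> l / ln 2" using l(1) by simp
      have "1 + \<bar>of_int j\<bar> * ?C \<le> l / ln 2 + l / ln 2 * ?C"
        using jle one by (intro add_mono mult_right_mono) auto
      also have "\<dots> \<le> osc_const (s / q) * l"
        using l(2) by (simp add: osc_const_def field_simps)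
      finally show "N * (1 + \<bar>of_int j\<bar> * ?C) \<le> osc_const (s / q) * N * l" using N by (simp add: mult_ac)
      have "2 powr (s / q) \<le> 2 powr (s / q) * (l / ln 2)" using mult_left_mono[OF one, of "2 powr (s / q)"] by simp
      also have "\<dots> \<le> osc_const (s / q) * l" using l(2) by (simp add: osc_const_def field_simps)
      finally show "N * 2 powr (s / q) \<le> osc_const (s / q) * N * l" using N by (simp add: mult_ac)
    qed auto
    also have "\<dots> = ennreal (osc_const (s / q) * N) * ?L * (1 + ?D * epowr m (s / q)) * u k"
      unfolding L unfolding m_def r(2) epowr_ennreal_pos[OF r(1)]
      using l N osc_const_pos[of "s / q"] by (simp add: ennreal_mult distrib_left mult.assoc)
    finally show ?thesis .
  qed
qed

end

section \<open>Herz and central mean oscillation norms as Lebesgue norms\<close>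

lemma Lnorm_eq_pnorm:
  assumes "q > 0" "E \<in> sets borel" and f0: "f0 \<in> borel_measurable borel" and eq: "AE x in lborel. f x = f0 x"
  shows "Lnorm E q (\<lambda>x. hnorm x powr \<beta>) f = pnorm (hweight \<beta>) q (\<lambda>x. ennreal (norm (f0 x)) * indicator E x)"
proof -
  note [measurable] = assms(2) f0
  have "(\<integral>\<^sup>+x\<in>E. ennreal (norm (f x) powr q * hnorm x powr \<beta>) \<partial>lebesgue)
    = (\<integral>\<^sup>+x. ennreal (hnorm x powr \<beta>) * epowr (ennreal (norm (f0 x)) * indicator E x) q \<partial>lborel)"
    unfolding nn_integral_completion
    by (rule nn_integral_cong_AE, use eq in eventually_elim)
      (use assms(1) in \<open>auto simp: indicator_def epowr_ennreal ennreal_mult mult.commute\<close>)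
  also have "\<dots> = (\<integral>\<^sup>+x. epowr (ennreal (norm (f0 x)) * indicator E x) q \<partial>hweight \<beta>)"
    by (rule nn_integral_hweight[symmetric]) measurable
  finally show ?thesis unfolding Lnorm_def pnorm_def by simp
qed

text \<open>The power law for \<open>v(B\<^sub>k)\<close> turns the Herz norm into an exponentially weighted sequence norm.\<close>

lemma herz_norm_eq_pnorm:
  fixes f f0 :: "'n::finite heis \<Rightarrow> complex"
  assumes "p > 0" "q > 0" "c > 0"
    and vol: "\<And>k. wmeasure (\<lambda>x. hnorm x powr \<beta>) (hB k :: 'n heis set) = ennreal (c * 2 powr (of_int k * s))"
    and f0: "f0 \<in> borel_measurable borel" "AE x in lborel. f x = f0 x"
  shows "herz_norm \<alpha> p q (\<lambda>x. hnorm x powr \<beta>) f = pnorm (count_space UNIV) p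
    (\<lambda>k. ennreal (c powr (\<alpha> / hdim TYPE('n)) * 2 powr (of_int k * (s * (\<alpha> / hdim TYPE('n)))))
      * pnorm (hweight \<beta>) q (\<lambda>x. ennreal (norm (f0 x)) * indicator (hE k) x))"
proof -
  have "epowr (ennreal (c * 2 powr (of_int k * s))) (\<alpha> * p / hdim TYPE('n))
    = epowr (ennreal (c powr (\<alpha> / hdim TYPE('n)) * 2 powr (of_int k * (s * (\<alpha> / hdim TYPE('n)))))) p" for k :: int
    using assms(1,3) by (simp add: epowr_real_mult_powr powr_powr)
      (simp add: powr_mult powr_powr mult_ac)
  then show ?thesis
    using assms(1,2) unfolding herz_norm_def pnorm_def[of "count_space UNIV"] vol infsum_ennreal_eq_nn_integral[OF countableI_type infinite_UNIV_int]
    by (simp add: epowr_mult Lnorm_eq_pnorm[OF _ sets_hE f0])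
qed

lemma cmo_norm_ball:
  fixes b b0 :: "'n::finite heis \<Rightarrow> complex"
  assumes "q > 0" "c > 0"
    and vol: "\<And>k. wmeasure (\<lambda>x. hnorm x powr \<beta>) (hB k :: 'n heis set) = ennreal (c * 2 powr (of_int k * s))"
    and b0: "b0 \<in> borel_measurable borel" "AE x in lborel. b x = b0 x"
  shows "pnorm (hweight \<beta>) q (\<lambda>x. ennreal (norm (b0 x - average (hB k) b)) * indicator (hB k) x)
    \<le> cmo_norm q (\<lambda>x. hnorm x powr \<beta>) b * epowr (emeasure (hweight \<beta>) (hB k :: 'n heis set)) (1 / q)"
proof -
  let ?v = "\<lambda>x::'n heis. hnorm x powr \<beta>" and ?N = "cmo_norm q (\<lambda>x. hnorm x powr \<beta>) b"
  let ?d = "\<lambda>x. b x - average (hB k) b" and ?V = "wmeasure (\<lambda>x. hnorm x powr \<beta>) (hB k :: 'n heis set)"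
  let ?I = "\<integral>\<^sup>+x\<in>hB k. ennreal (norm (?d x) powr q * ?v x) \<partial>lebesgue"
  have V: "?V \<noteq> 0" "?V \<noteq> \<infinity>" unfolding vol using assms(2) by (auto simp: ennreal_eq_0_iff not_le)
  have "epowr (?I / ?V) (1 / q) \<le> ?N"
    unfolding cmo_norm_def hB_eq_hball by (rule SUP_upper) simp
  then have "?I / ?V \<le> epowr ?N q" using assms(1) by (simp add: epowr_le_iff)
  then have "?I / ?V * ?V \<le> epowr ?N q * ?V" by (rule mult_right_mono) simp
  also have "?I / ?V * ?V = ?I"
    using V by (simp add: divide_ennreal_def mult.assoc ennreal_inverse_mult)
  finally have "Lnorm (hB k) q ?v ?d \<le> epowr (epowr ?N q * ?V) (1 / q)"
    unfolding Lnorm_def using assms(1) by (intro epowr_mono) auto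
  also have "\<dots> = ?N * epowr ?V (1 / q)" using assms(1) by (simp add: epowr_mult)
  finally show ?thesis
    using assms(1) b0 by (simp add: Lnorm_eq_pnorm[OF _ sets_hB, of q "\<lambda>x. b0 x - average (hB k) b"] wmeasure_hweight)
qed

section \<open>The commutator estimate for Borel data\<close>

definition kernel_bound ::
  "real \<Rightarrow> real \<Rightarrow> real \<Rightarrow> real \<Rightarrow> ('n::finite heis \<Rightarrow> complex) \<Rightarrow> ('n heis \<Rightarrow> 'n hmat) \<Rightarrow> 'n heis \<Rightarrow> ennreal" where
  "kernel_bound q q1 \<alpha>1 \<beta> \<Phi> A y = Theta q q1 \<beta> \<Phi> A y *
    (if \<alpha>1 = 0 then 1 + elog 2 (hmnorm (matrix_inv (A y)) * hmnorm (A y))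
     else hG (matrix_inv (A y)) (\<alpha>1 * (hdim TYPE('n) + \<beta>) / hdim TYPE('n)))"

lemma K3_eq: "K3 q q1 \<alpha>1 \<beta> \<Phi> A = (\<integral>\<^sup>+y. kernel_bound q q1 \<alpha>1 \<beta> \<Phi> A y \<partial>lborel)"
  by (simp add: K3_def kernel_bound_def nn_integral_completion)

lemma kernel_bound_cong:
  "\<Phi> y = \<Phi>' y \<Longrightarrow> A y = A' y \<Longrightarrow> kernel_bound q q1 \<alpha>1 \<beta> \<Phi> A y = kernel_bound q q1 \<alpha>1 \<beta> \<Phi>' A' y"
  by (simp add: kernel_bound_def Theta_def)

lemma borel_measurable_matrix_vector_mult_pair [measurable]:
  fixes A :: "'a::euclidean_space \<Rightarrow> real^'n^'m"
  assumes "A \<in> borel_measurable borel"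
  shows "(\<lambda>(x, y). A y *v x) \<in> borel_measurable (lborel \<Otimes>\<^sub>M lborel)"
  unfolding matrix_vector_mult_def case_prod_beta
  by (intro borel_measurable_vec_lambda borel_measurable_sum borel_measurable_times borel_measurable_vec_nth
      measurable_compose[OF measurable_snd] measurable_compose[OF measurable_fst])
    (use assms in auto)

lemma measurable_comm_integrand:
  fixes \<Phi> b f :: "'n::finite heis \<Rightarrow> complex"
  assumes "\<Phi> \<in> borel_measurable borel" "A \<in> borel_measurable borel" "b \<in> borel_measurable borel" "f \<in> borel_measurable borel"
  shows "(\<lambda>(x, y). comm_integrand \<Phi> A b f x y) \<in> borel_measurable (lborel \<Otimes>\<^sub>M lborel)"
proof -
  have 1: "(\<lambda>z. A (snd z) *v fst z) \<in> borel_measurable (lborel \<Otimes>\<^sub>M lborel)"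
    using borel_measurable_matrix_vector_mult_pair[OF assms(2)] by (simp add: case_prod_beta)
  note [measurable] = assms(1,3,4) measurable_compose[OF 1 assms(3)] measurable_compose[OF 1 assms(4)]
  show ?thesis unfolding comm_integrand_def case_prod_beta by measurable
qed

text \<open>Abbreviations for one fixed choice of Borel data: \<open>w1\<close> and \<open>w2\<close> are the Herz weights of exponents \<open>\<alpha>1\<close> and
  \<open>\<alpha>2\<close>, \<open>a k\<close> is the norm of \<open>f\<close> on the shell \<open>E\<^sub>k\<close>, and \<open>D k y\<close> is the norm on \<open>E\<^sub>k\<close> of the contribution of \<open>y\<close> to
  the commutator.\<close>

locale commutator_setting = central_oscillation q \<beta> s c0 N b c u
  for q \<beta> s c0 N :: real and b :: "'n::finite heis \<Rightarrow> complex" and c u +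
  fixes p q1 q2 \<alpha>1 \<alpha>2 Q :: real and f \<Phi> :: "'n heis \<Rightarrow> complex" and A :: "'n heis \<Rightarrow> 'n hmat"
    and w1 w2 :: "int \<Rightarrow> ennreal" and D :: "int \<Rightarrow> 'n heis \<Rightarrow> ennreal" and a :: "int \<Rightarrow> ennreal"
  assumes p: "p \<ge> 1" and q1: "q1 > 1" and q2: "q2 > 1" and Q: "Q = hdim TYPE('n)"
    and exponents: "1 / q2 = 1 / q + 1 / q1" "1 / q + \<alpha>2 / Q = \<alpha>1 / Q"
    and f [measurable]: "f \<in> borel_measurable borel" and \<Phi> [measurable]: "\<Phi> \<in> borel_measurable borel"
    and A [measurable]: "A \<in> borel_measurable borel"
    and det: "AE y in lborel. \<Phi> y \<noteq> 0 \<longrightarrow> det (A y) \<noteq> 0"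
    and w1: "\<And>k. w1 k = ennreal (c0 powr (\<alpha>1 / Q) * 2 powr (of_int k * (s * (\<alpha>1 / Q))))"
    and w2: "\<And>k. w2 k = ennreal (c0 powr (\<alpha>2 / Q) * 2 powr (of_int k * (s * (\<alpha>2 / Q))))"
    and a: "\<And>k. a k = pnorm (hweight \<beta>) q1 (\<lambda>x. ennreal (norm (f x)) * indicator (hE k) x)"
    and D: "\<And>k y. D k y = pnorm (hweight \<beta>) q2 (\<lambda>x. ennreal (norm (comm_integrand \<Phi> A b f x y)) * indicator (hE k) x)"
begin

text \<open>This is the relation \<open>1/q + \<alpha>\<^sub>2/Q = \<alpha>\<^sub>1/Q\<close>: the factor \<open>v(B\<^sub>k)\<^sup>1\<^sup>/\<^sup>q\<close> lost to \<open>b\<close> is what separates the two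
  Herz scales.\<close>

lemma w2_u: "w2 k * u k = w1 k"
proof -
  have "w2 k * u k = ennreal (c0 powr (\<alpha>2 / Q + 1 / q) * 2 powr (of_int k * (s * (\<alpha>2 / Q + 1 / q))))"
    unfolding w2 u_eq powr_add distrib_left by (simp add: mult_ac flip: ennreal_mult)
  then show ?thesis unfolding w1 using exponents(2) by (simp add: add.commute)
qed

lemma D_le:
  assumes y: "det (A y) \<noteq> 0" and I: "\<And>m x. x \<in> hE k \<Longrightarrow> A y *v x \<in> hE (k + m) \<Longrightarrow> m \<in> I"
  shows "D k y \<le> ennreal (osc_const (s / q) * N) * Theta q q1 \<beta> \<Phi> A y * u k
    * (\<integral>\<^sup>+m. indicator I m * a (k + m) \<partial>count_space UNIV)"
proof -
  let ?M = "A y" and ?\<phi> = "ennreal (norm (\<Phi> y) / hnorm y powr Q)"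
  let ?B = "\<lambda>x. ennreal (norm (b x - b (?M *v x))) * indicator (hB k) x"
  let ?F = "\<lambda>x. ennreal (norm (f (?M *v x))) * indicator (hE k) x"
  let ?S = "\<integral>\<^sup>+m. indicator I m * a (k + m) \<partial>count_space UNIV"
  have [measurable]: "(\<lambda>x. b (?M *v x)) \<in> borel_measurable borel" "(\<lambda>x. f (?M *v x)) \<in> borel_measurable borel"
    by (rule measurable_compose[OF borel_measurable_matrix_vector_mult], use b f in simp)+
  note [measurable] = b
  have "D k y = pnorm (hweight \<beta>) q2 (\<lambda>x. ?\<phi> * (?B x * ?F x))"
    unfolding D
  proof (rule arg_cong[where f = "pnorm (hweight \<beta>) q2"], rule ext)
    fix x
    show "ennreal (norm (comm_integrand \<Phi> A b f x y)) * indicator (hE k) x = ?\<phi> * (?B x * ?F x)"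
    proof (cases "x \<in> hE k")
      case True
      then have "x \<in> hB k" by (simp add: hE_def)
      then show ?thesis using True
        by (simp add: comm_integrand_def norm_mult norm_divide Q mult.assoc flip: ennreal_mult)
    qed simp
  qed
  also have "\<dots> = ?\<phi> * pnorm (hweight \<beta>) q2 (\<lambda>x. ?B x * ?F x)"
    using q2 by (intro pnorm_cmult) auto
  also have "\<dots> \<le> ?\<phi> * (pnorm (hweight \<beta>) q ?B * pnorm (hweight \<beta>) q1 ?F)"
    using q q1 q2 exponents(1) by (intro mult_left_mono Hoelder) auto
  also have "\<dots> \<le> ?\<phi> * ((ennreal (osc_const (s / q) * N) * (if hmnorm ?M < 1 then elog (exp 1) (2 / hmnorm ?M) else elog (exp 1) (2 * hmnorm ?M))
      * (1 + ennreal (\<bar>det (matrix_inv ?M)\<bar> powr (1 / q)) * hG (matrix_inv ?M) (\<beta> / q) * epowr (hmnorm ?M) (s / q)) * u k)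
      * (ennreal (\<bar>det (matrix_inv ?M)\<bar> powr (1 / q1)) * hG (matrix_inv ?M) (\<beta> / q1) * ?S))"
    unfolding a
    using q1 by (intro mult_left_mono mult_mono pnorm_difference_le[OF y] pnorm_hE_matrix_le[OF y _ _ I]) auto
  also have "\<dots> = ennreal (osc_const (s / q) * N) * Theta q q1 \<beta> \<Phi> A y * u k * ?S"
    unfolding Theta_def Let_def s(1) Q by (simp only: mult_ac)
  finally show ?thesis .
qed

text \<open>The bound for one elementary operator \<open>f \<mapsto> (b - b \<circ> A(y)) (f \<circ> A(y))\<close> between the Herz spaces.\<close>

lemma weighted_D_le:
  assumes y: "\<Phi> y \<noteq> 0 \<longrightarrow> det (A y) \<noteq> 0"
  shows "pnorm (count_space UNIV) p (\<lambda>k. w2 k * D k y)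
    \<le> ennreal (osc_const (s / q) * N * shift_const (s * (\<alpha>1 / Q))) * pnorm (count_space UNIV) p (\<lambda>k. w1 k * a k)
      * kernel_bound q q1 \<alpha>1 \<beta> \<Phi> A y"
proof (cases "\<Phi> y = 0")
  case True
  then have "D k y = 0" for k
    using q2 unfolding D by (simp add: comm_integrand_def pnorm_def)
  then show ?thesis using p by (simp add: pnorm_def)
next
  case False
  with y have M: "det (A y) \<noteq> 0" by simp
  let ?\<sigma> = "s * (\<alpha>1 / Q)" and ?C = "ennreal (osc_const (s / q) * N)"
  let ?K = "if ?\<sigma> = 0 then 1 + elog 2 (hmnorm (matrix_inv (A y)) * hmnorm (A y)) else hG (matrix_inv (A y)) ?\<sigma>"
  let ?F = "pnorm (count_space UNIV) p (\<lambda>k. w1 k * a k)"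
  obtain I where I: "\<And>k m x. x \<in> hE k \<Longrightarrow> A y *v x \<in> hE (k + m) \<Longrightarrow> m \<in> I"
    and sum: "shift_sum ?\<sigma> I \<le> ennreal (shift_const ?\<sigma>) * ?K"
    by (rule shift_sum_indices_bound[OF M, of ?\<sigma>], rule that)
  let ?S = "\<lambda>k. \<integral>\<^sup>+m. indicator I m * a (k + m) \<partial>count_space UNIV"
  have "pnorm (count_space UNIV) p (\<lambda>k. w2 k * D k y)
    \<le> pnorm (count_space UNIV) p (\<lambda>k. ?C * Theta q q1 \<beta> \<Phi> A y * (w1 k * ?S k))"
  proof (rule pnorm_mono_AE)
    have "w2 k * D k y \<le> w2 k * (?C * Theta q q1 \<beta> \<Phi> A y * u k * ?S k)" for k
      by (intro mult_left_mono D_le[OF M I]) auto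
    also have "w2 k * (?C * Theta q q1 \<beta> \<Phi> A y * u k * ?S k) = ?C * Theta q q1 \<beta> \<Phi> A y * (w1 k * ?S k)" for k
      unfolding w2_u[symmetric] by (simp only: mult_ac)
    finally show "AE k in count_space UNIV. w2 k * D k y \<le> ?C * Theta q q1 \<beta> \<Phi> A y * (w1 k * ?S k)" by simp
  qed (use p in simp)
  also have "\<dots> = ?C * Theta q q1 \<beta> \<Phi> A y * pnorm (count_space UNIV) p (\<lambda>k. w1 k * ?S k)"
    using p by (intro pnorm_cmult) auto
  also have "\<dots> \<le> ?C * Theta q q1 \<beta> \<Phi> A y * (shift_sum ?\<sigma> I * ?F)"
    unfolding w1 using p c0 by (intro mult_left_mono pnorm_shift) auto
  also have "\<dots> \<le> ?C * Theta q q1 \<beta> \<Phi> A y * (ennreal (shift_const ?\<sigma>) * ?K * ?F)"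
    by (intro mult_left_mono mult_right_mono sum) simp_all
  also have "?C * Theta q q1 \<beta> \<Phi> A y * (ennreal (shift_const ?\<sigma>) * ?K * ?F)
    = ennreal (osc_const (s / q) * N * shift_const ?\<sigma>) * ?F * (Theta q q1 \<beta> \<Phi> A y * ?K)"
    using N osc_const_pos[of "s / q"] shift_const_pos[of ?\<sigma>] by (simp add: ennreal_mult mult_ac)
  also have "Theta q q1 \<beta> \<Phi> A y * ?K = kernel_bound q q1 \<alpha>1 \<beta> \<Phi> A y"
    using s(2) hdim_pos[where 'n='n] unfolding kernel_bound_def Q[symmetric] by (simp add: s(1) Q[symmetric] mult.commute)
  finally show ?thesis .
qed

lemma measurable_kernel: "(\<lambda>(x, y). ennreal (norm (comm_integrand \<Phi> A b f x y))) \<in> borel_measurable (lborel \<Otimes>\<^sub>M lborel)"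
  using measurable_comm_integrand[OF \<Phi> A b f] unfolding case_prod_beta by measurable

abbreviation "T x \<equiv> \<integral>\<^sup>+y. ennreal (norm (comm_integrand \<Phi> A b f x y)) \<partial>lborel"

lemma measurable_kernel_shell:
  "(\<lambda>(x, y). ennreal (norm (comm_integrand \<Phi> A b f x y)) * indicator (hE k) x) \<in> borel_measurable (hweight \<beta> \<Otimes>\<^sub>M lborel)"
proof -
  have "(\<lambda>z. ennreal (norm (comm_integrand \<Phi> A b f (fst z) (snd z))) * indicator (hE k) (fst z)) \<in> borel_measurable (lborel \<Otimes>\<^sub>M lborel)"
  proof (rule borel_measurable_times_ennreal)
    show "(\<lambda>z. ennreal (norm (comm_integrand \<Phi> A b f (fst z) (snd z)))) \<in> borel_measurable (lborel \<Otimes>\<^sub>M lborel)"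
      using measurable_kernel by (simp only: case_prod_beta')
  qed (rule borel_measurable_indicator', measurable)
  moreover have "sets (hweight \<beta> \<Otimes>\<^sub>M lborel :: ('n heis \<times> 'n heis) measure) = sets (lborel \<Otimes>\<^sub>M lborel)"
    by (rule sets_pair_measure_cong) auto
  ultimately show ?thesis unfolding case_prod_beta using measurable_cong_sets by blast
qed

lemma measurable_D: "D k \<in> borel_measurable borel"
proof -
  interpret sigma_finite_measure "hweight \<beta> :: 'n heis measure" by (rule sigma_finite_hweight)
  have "(\<lambda>(y, x). epowr (ennreal (norm (comm_integrand \<Phi> A b f x y)) * indicator (hE k) x) q2) \<in> borel_measurable (lborel \<Otimes>\<^sub>M hweight \<beta>)"
    using measurable_epowr[OF measurable_pair_swap[OF measurable_kernel_shell]] by (simp add: case_prod_beta)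
  then have "(\<lambda>y. \<integral>\<^sup>+x. epowr (ennreal (norm (comm_integrand \<Phi> A b f x y)) * indicator (hE k) x) q2 \<partial>hweight \<beta>) \<in> borel_measurable lborel"
    by (rule borel_measurable_nn_integral)
  then have "(\<lambda>y. D k y) \<in> borel_measurable lborel"
    unfolding D pnorm_def by (rule measurable_epowr)
  then show ?thesis by simp
qed

text \<open>Minkowski's inequality moves the norm over \<open>x\<close>, and then the norm over \<open>k\<close>, inside the integral over \<open>y\<close>.\<close>

theorem herz_commutator_le:
  assumes fin: "pnorm (count_space UNIV) p (\<lambda>k. w1 k * a k) < \<infinity>"
  shows "pnorm (count_space UNIV) p (\<lambda>k. w2 k * pnorm (hweight \<beta>) q2 (\<lambda>x. T x * indicator (hE k) x))
    \<le> ennreal (osc_const (s / q) * N * shift_const (s * (\<alpha>1 / Q))) * pnorm (count_space UNIV) p (\<lambda>k. w1 k * a k)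
      * (\<integral>\<^sup>+y. kernel_bound q q1 \<alpha>1 \<beta> \<Phi> A y \<partial>lborel)"
proof -
  let ?P = "pnorm (count_space (UNIV :: int set)) p"
  let ?C = "ennreal (osc_const (s / q) * N * shift_const (s * (\<alpha>1 / Q))) * ?P (\<lambda>k. w1 k * a k)"
  note [measurable] = measurable_D
  have shell: "pnorm (hweight \<beta>) q2 (\<lambda>x. T x * indicator (hE k) x) \<le> (\<integral>\<^sup>+y. D k y \<partial>lborel)" for k
  proof -
    have "T x * indicator (hE k) x = (\<integral>\<^sup>+y. ennreal (norm (comm_integrand \<Phi> A b f x y)) * indicator (hE k) x \<partial>lborel)" for x
      by (cases "x \<in> hE k") auto
    then show ?thesis
      unfolding D using q2 sigma_finite_hweight lborel.sigma_finite_measure_axioms measurable_kernel_shell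
      by (simp only:) (rule Minkowski_integral, auto)
  qed
  have "?P (\<lambda>k. w2 k * pnorm (hweight \<beta>) q2 (\<lambda>x. T x * indicator (hE k) x)) \<le> ?P (\<lambda>k. \<integral>\<^sup>+y. w2 k * D k y \<partial>lborel)"
    using p by (intro pnorm_mono_AE) (auto simp: nn_integral_cmult intro!: mult_left_mono shell)
  also have "\<dots> \<le> (\<integral>\<^sup>+y. ?P (\<lambda>k. w2 k * D k y) \<partial>lborel)"
  proof (rule Minkowski_integral[OF p])
    show "(\<lambda>(k, y). w2 k * D k y) \<in> borel_measurable (count_space UNIV \<Otimes>\<^sub>M lborel)"
      by (rule measurable_pair_measure_countable1) auto
  qed (auto intro: sigma_finite_measure_count_space_countable lborel.sigma_finite_measure_axioms)
  also have "\<dots> \<le> (\<integral>\<^sup>+y. ?C * kernel_bound q q1 \<alpha>1 \<beta> \<Phi> A y \<partial>lborel)"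
    by (intro nn_integral_mono_AE) (use det in eventually_elim, rule weighted_D_le)
  also have "\<dots> \<le> ?C * (\<integral>\<^sup>+y. kernel_bound q q1 \<alpha>1 \<beta> \<Phi> A y \<partial>lborel)"
    using fin by (intro nn_integral_cmult_le) (auto simp: ennreal_mult_less_top)
  finally show ?thesis .
qed

end

section \<open>Borel representatives\<close>

text \<open>The real-valued case is applied to each coordinate.\<close>

lemma lebesgue_measurable_ex_borel:
  fixes f :: "'a::euclidean_space \<Rightarrow> 'b::euclidean_space"
  assumes "f \<in> borel_measurable lebesgue"
  obtains g where "g \<in> borel_measurable borel" "AE x in lborel. f x = g x"
proof -
  have "\<exists>g\<in>borel_measurable lborel. AE x in lborel. f x \<bullet> b = g x" for b
    by (rule completion_ex_borel_measurable_real) (simp add: assms borel_measurable_inner)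
  then obtain G where G: "\<And>b. G b \<in> borel_measurable lborel" "\<And>b. AE x in lborel. f x \<bullet> b = G b x"
    by metis
  show ?thesis
  proof
    show "(\<lambda>x. \<Sum>b\<in>Basis. G b x *\<^sub>R b) \<in> borel_measurable borel" using G(1) by simp
    have "AE x in lborel. \<forall>b\<in>Basis. f x \<bullet> b = G b x" using G(2) by (intro eventually_ball_finite) auto
    then show "AE x in lborel. f x = (\<Sum>b\<in>Basis. G b x *\<^sub>R b)"
      by eventually_elim (metis (no_types, lifting) euclidean_representation sum.cong)
  qed
qed

lemma lebesgue_measurable_cong_AE:
  fixes f g :: "'a::euclidean_space \<Rightarrow> 'b::euclidean_space"
  assumes "g \<in> borel_measurable borel" "AE x in lborel. f x = g x"
  shows "f \<in> borel_measurable lebesgue"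
proof (rule borel_measurable_AE)
  show "g \<in> borel_measurable lebesgue" using assms(1) by (simp add: measurable_completion)
  show "AE x in lebesgue. g x = f x"
    using AE_completion[OF assms(2)] by eventually_elim simp
qed

lemma loc_integrable_measurable:
  fixes f :: "'n::finite heis \<Rightarrow> complex"
  assumes "loc_integrable f" shows "f \<in> borel_measurable lebesgue"
proof (rule borel_measurable_LIMSEQ_metric[where f = "\<lambda>n x. indicat_real (cball 0 (real n)) x *\<^sub>R f x"])
  fix n
  have "set_integrable lebesgue (cball 0 (real n)) f"
    using assms compact_cball unfolding loc_integrable_def by blast
  then show "(\<lambda>x. indicat_real (cball 0 (real n)) x *\<^sub>R f x) \<in> borel_measurable lebesgue"
    unfolding set_integrable_def by (rule borel_measurable_integrable)
next
  fix x :: "'n heis"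
  obtain n0 where n0: "norm x \<le> real n0" using real_arch_simple by blast
  have "\<forall>\<^sub>F n in sequentially. indicat_real (cball 0 (real n)) x *\<^sub>R f x = f x"
    using eventually_ge_at_top[of n0]
  proof eventually_elim
    case (elim n)
    then have "x \<in> cball 0 (real n)" using n0 by simp
    then show ?case by simp
  qed
  then show "(\<lambda>n. indicat_real (cball 0 (real n)) x *\<^sub>R f x) \<longlonglongrightarrow> f x"
    by (rule tendsto_eventually)
qed

text \<open>For fixed \<open>y\<close> with \<open>\<Phi> y \<noteq> 0\<close> the matrix \<open>A y\<close> is invertible, so \<open>A y *v x\<close> avoids a given null set for almost
  every \<open>x\<close>.  Fubini's theorem exchanges the quantifiers.\<close>

lemma comm_integrand_borel_AE:
  fixes \<Phi> \<Phi>0 b b0 f f0 :: "'n::finite heis \<Rightarrow> complex" and A A0 :: "'n heis \<Rightarrow> 'n hmat"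
  assumes meas: "\<Phi>0 \<in> borel_measurable borel" "A0 \<in> borel_measurable borel"
    and eq: "AE y in lborel. \<Phi> y = \<Phi>0 y" "AE y in lborel. A y = A0 y" "AE x in lborel. b x = b0 x" "AE x in lborel. f x = f0 x"
    and det: "AE y in lborel. \<Phi>0 y \<noteq> 0 \<longrightarrow> det (A0 y) \<noteq> 0"
  shows "AE x in lborel. AE y in lborel. comm_integrand \<Phi> A b f x y = comm_integrand \<Phi>0 A0 b0 f0 x y"
proof -
  have "AE x in lborel. b x = b0 x \<and> f x = f0 x" using eq(3,4) by eventually_elim simp
  then obtain N where N: "N \<in> null_sets lborel" "\<And>x. x \<notin> N \<Longrightarrow> b x = b0 x \<and> f x = f0 x"
    by (rule AE_E3) simp
  then have [measurable]: "N \<in> sets borel" by auto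
  let ?R = "\<lambda>x y. \<Phi>0 y = 0 \<or> A0 y *v x \<notin> N"
  have [measurable]: "(\<lambda>z. A0 (snd z) *v fst z) \<in> borel_measurable (lborel \<Otimes>\<^sub>M lborel)"
    using borel_measurable_matrix_vector_mult_pair[OF meas(2)] by (simp add: case_prod_beta)
  note [measurable] = meas(1)
  have "{z \<in> space (lborel \<Otimes>\<^sub>M lborel). ?R (fst z) (snd z)} \<in> sets (lborel \<Otimes>\<^sub>M lborel)"
    by measurable
  moreover have "AE y in lborel. AE x in lborel. ?R x y"
    using det
  proof eventually_elim
    case (elim y)
    show ?case
    proof (cases "\<Phi>0 y = 0")
      case False
      then show ?thesis using AE_lborel_matrix[OF _ N(1), of "A0 y"] elim by simp
    qed simp
  qed
  ultimately have "AE x in lborel. AE y in lborel. ?R x y" by (subst lborel_pair.AE_commute)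
  moreover have "AE x in lborel. x \<notin> N" using N(1) by (rule AE_not_in)
  ultimately show ?thesis
  proof eventually_elim
    case (elim x)
    from elim(1) eq(1,2) show ?case
    proof eventually_elim
      case (elim y)
      then show ?case using N(2)[OF \<open>x \<notin> N\<close>] N(2)[of "A0 y *v x"]
        by (cases "\<Phi>0 y = 0") (auto simp: comm_integrand_def)
    qed
  qed
qed

lemma compact_subset_shells:
  assumes "compact K" "K \<subseteq> - {0 :: 'n::finite heis}"
  obtains J where "finite J" "K \<subseteq> (\<Union>k\<in>J. hE k)"
proof (cases "K = {}")
  case False
  obtain x0 where x0: "x0 \<in> K" "\<And>x. x \<in> K \<Longrightarrow> hnorm x0 \<le> hnorm x"
    using continuous_attains_inf[OF assms(1) False continuous_on_hnorm] by blast
  obtain x1 where x1: "x1 \<in> K" "\<And>x. x \<in> K \<Longrightarrow> hnorm x \<le> hnorm x1"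
    using continuous_attains_sup[OF assms(1) False continuous_on_hnorm] by blast
  obtain k0 k1 where k: "x0 \<in> hE k0" "x1 \<in> hE k1" using ex_hE x0(1) x1(1) assms(2) by blast
  show thesis
  proof (rule that[of "{k0..k1}"])
    show "K \<subseteq> (\<Union>k\<in>{k0..k1}. hE k)"
    proof
      fix x assume x: "x \<in> K"
      then obtain l where l: "x \<in> hE l" using ex_hE assms(2) by blast
      have "2 powr (of_int k0 - 1) < (2::real) powr of_int l" "2 powr (of_int l - 1) < (2::real) powr of_int k1"
        using k l x0(2)[OF x] x1(2)[OF x] unfolding hE_iff by linarith+
      then have "of_int k0 - 1 < real_of_int l" "of_int l - 1 < real_of_int k1"
        using powr_less_cancel_iff[of "2::real"] by auto
      then have "l \<in> {k0..k1}" by auto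
      then show "x \<in> (\<Union>k\<in>{k0..k1}. hE k)" using l by blast
    qed
  qed simp
qed (use that[of "{}"] in simp)

lemma Lloc_punctured:
  fixes g :: "'n::finite heis \<Rightarrow> complex"
  assumes "q > 0" "g \<in> borel_measurable lebesgue" and w: "w \<in> borel_measurable borel"
    and fin: "\<And>k. Lnorm (hE k) q w g < \<infinity>"
  shows "g \<in> Lloc (- {0}) q w"
  unfolding Lloc_def
proof (safe, fact)
  fix K :: "'n heis set" assume "compact K" "K \<subseteq> - {0}"
  then obtain J where J: "finite J" "K \<subseteq> (\<Union>k\<in>J. hE k)" by (rule compact_subset_shells)
  let ?h = "\<lambda>x. ennreal (norm (g x) powr q * w x)"
  have "w \<in> borel_measurable lebesgue" using w by (simp add: measurable_completion)
  then have [measurable]: "?h \<in> borel_measurable lebesgue"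
    using assms(2) by measurable
  have [measurable]: "hE k \<in> sets lebesgue" for k :: int by simp
  have "(\<integral>\<^sup>+x\<in>K. ?h x \<partial>lebesgue) \<le> (\<integral>\<^sup>+x. (\<Sum>k\<in>J. ?h x * indicator (hE k) x) \<partial>lebesgue)"
  proof (rule nn_integral_mono)
    fix x
    show "?h x * indicator K x \<le> (\<Sum>k\<in>J. ?h x * indicator (hE k) x)"
    proof (cases "x \<in> K")
      case True
      then obtain k where k: "k \<in> J" "x \<in> hE k" using J by blast
      have "?h x * indicator (hE k) x \<le> (\<Sum>k\<in>J. ?h x * indicator (hE k) x)"
        by (rule member_le_sum[OF k(1)]) (use J in auto)
      then show ?thesis using k True by simp
    qed simp
  qed
  also have "\<dots> = (\<Sum>k\<in>J. \<integral>\<^sup>+x\<in>hE k. ?h x \<partial>lebesgue)" by (rule nn_integral_sum) measurable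
  also have "\<dots> < \<infinity>"
  proof -
    have "(\<integral>\<^sup>+x\<in>hE k. ?h x \<partial>lebesgue) \<noteq> top" for k
      using fin[of k] assms(1) epowr_eq_top_iff[of "1 / q"] unfolding Lnorm_def by fastforce
    then show ?thesis using J(1) by (auto simp: less_top)
  qed
  finally show "Lnorm K q w g < \<infinity>"
    using assms(1) epowr_eq_top_iff[of "1 / q"] unfolding Lnorm_def by (simp flip: less_top)
qed

lemma pnorm_finite_imp_component_finite:
  fixes W g :: "int \<Rightarrow> ennreal"
  assumes "p > 0" "pnorm (count_space UNIV) p (\<lambda>k. W k * g k) < \<infinity>" "W k \<noteq> 0"
  shows "g k < \<infinity>"
proof -
  have "epowr (W k * g k) p \<le> (\<integral>\<^sup>+k. epowr (W k * g k) p \<partial>count_space UNIV)"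
    by (rule nn_integral_ge_point) simp
  also have "\<dots> < \<infinity>"
    using assms(1,2) epowr_eq_top_iff[of "1 / p"] unfolding pnorm_def by (simp flip: less_top)
  finally have "W k * g k \<noteq> top" using assms(1) epowr_eq_top_iff[of p "W k * g k"] by auto
  then show ?thesis using assms(3) by (auto simp: ennreal_mult_eq_top_iff less_top)
qed


text \<open>The finiteness of \<open>Y\<close> makes multiplication by \<open>Y\<close> continuous from the right, also at \<open>n = 0\<close>.\<close>

lemma ennreal_mult_right_limit:
  fixes L Y :: ennreal
  assumes Y: "Y < \<infinity>" and "n \<ge> 0" and le: "\<And>m. m > n \<Longrightarrow> L \<le> Y * ennreal m"
  shows "L \<le> Y * ennreal n"
proof (rule ennreal_le_epsilon)
  fix e :: real assume e: "e > 0"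
  obtain X where X: "X \<ge> 0" "Y = ennreal X" using Y by (cases Y) auto
  define d where "d = e / (X + 1)"
  have d: "d > 0" "X * d \<le> e" using e X by (auto simp: d_def field_simps)
  have "L \<le> Y * ennreal (n + d)" using d by (intro le) simp
  also have "\<dots> = ennreal (X * (n + d))" unfolding X(2) using X(1) by (simp add: ennreal_mult')
  also have "\<dots> \<le> ennreal (X * n + e)" using d by (intro ennreal_leI) (simp add: distrib_left)
  also have "\<dots> = ennreal (X * n) + ennreal e" using X(1) assms(2) e by (intro ennreal_plus) auto
  also have "ennreal (X * n) = Y * ennreal n" unfolding X(2) using X(1) by (rule ennreal_mult')
  finally show "L \<le> Y * ennreal n + ennreal e" .
qed

section \<open>The commutator on weighted Herz spaces\<close>

theorem theorem3p2:
  fixes p q q1 q2 \<alpha>1 \<alpha>2 \<beta> :: real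
    and v :: "'n::finite heis \<Rightarrow> real"
  assumes "1 \<le> p" and "1 < q" and "1 < q1" and "1 < q2"
    and "\<beta> > - real CARD('n)"
    and "v = (\<lambda>x. hnorm x powr \<beta>)"
    and "1 / q2 = 1 / q + 1 / q1"
    and "1 / q + \<alpha>2 / hdim TYPE('n) = \<alpha>1 / hdim TYPE('n)"
  shows "\<exists>C>0. \<forall>(\<Phi> :: 'n heis \<Rightarrow> complex) (A :: 'n heis \<Rightarrow> 'n hmat).
    loc_integrable \<Phi> \<and> A \<in> borel_measurable lebesgue
      \<and> (AE y in lebesgue. y \<in> closure {z. \<Phi> z \<noteq> 0} \<longrightarrow> det (A y) \<noteq> 0)
      \<and> K3 q q1 \<alpha>1 \<beta> \<Phi> A < \<infinity> \<longrightarrow>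
    (\<forall>b \<in> cmo q v. \<forall>f \<in> herz \<alpha>1 p q1 v.
      (AE x in lebesgue. integrable lebesgue (comm_integrand \<Phi> A b f x))
      \<and> hausdorff_comm \<Phi> A b f \<in> herz \<alpha>2 p q2 v
      \<and> herz_norm \<alpha>2 p q2 v (hausdorff_comm \<Phi> A b f)
          \<le> ennreal C * K3 q q1 \<alpha>1 \<beta> \<Phi> A * cmo_norm q v b * herz_norm \<alpha>1 p q1 v f)"
proof -
  let ?Q = "hdim TYPE('n)"
  define s where "s = ?Q + \<beta>"
  have s: "s > 0" using assms(5) by (simp add: s_def hdim_def)
  obtain c0 where c0: "c0 > 0" and vol: "\<And>k. wmeasure (\<lambda>x. hnorm x powr \<beta>) (hB k :: 'n heis set) = ennreal (c0 * 2 powr (of_int k * s))"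
    by (rule hweight_hB[OF s[unfolded s_def], folded s_def], rule that)
  define C where "C = osc_const (s / q) * shift_const (s * (\<alpha>1 / ?Q))"
  have C: "C > 0" by (simp add: C_def osc_const_pos shift_const_pos)
  show ?thesis
  proof (intro exI[of _ C] conjI[OF C] allI impI ballI, elim conjE)
    fix \<Phi> b f :: "'n heis \<Rightarrow> complex" and A :: "'n heis \<Rightarrow> 'n hmat"
    assume \<Phi>: "loc_integrable \<Phi>" and A: "A \<in> borel_measurable lebesgue"
      and det: "AE y in lebesgue. y \<in> closure {z. \<Phi> z \<noteq> 0} \<longrightarrow> det (A y) \<noteq> 0"
      and K3: "K3 q q1 \<alpha>1 \<beta> \<Phi> A < \<infinity>" and b: "b \<in> cmo q v" and f: "f \<in> herz \<alpha>1 p q1 v"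
    obtain \<Phi>0 where \<Phi>0: "\<Phi>0 \<in> borel_measurable borel" "AE y in lborel. \<Phi> y = \<Phi>0 y"
      using lebesgue_measurable_ex_borel[OF loc_integrable_measurable[OF \<Phi>]] .
    obtain A0 where A0: "A0 \<in> borel_measurable borel" "AE y in lborel. A y = A0 y"
      using lebesgue_measurable_ex_borel[OF A] .
    have "b \<in> borel_measurable lebesgue" using b by (simp add: cmo_def Lloc_def)
    then obtain b0 where b0: "b0 \<in> borel_measurable borel" "AE x in lborel. b x = b0 x"
      by (rule lebesgue_measurable_ex_borel)
    have "f \<in> borel_measurable lebesgue" using f by (simp add: herz_def Lloc_def)
    then obtain f0 where f0: "f0 \<in> borel_measurable borel" "AE x in lborel. f x = f0 x"
      by (rule lebesgue_measurable_ex_borel)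
    \<comment> \<open>The closure of \<open>{z. \<Phi> z \<noteq> 0}\<close> contains this set, and \<open>\<Phi>0\<close> vanishes off it almost everywhere.\<close>
    have det0: "AE y in lborel. \<Phi>0 y \<noteq> 0 \<longrightarrow> det (A0 y) \<noteq> 0"
      using det[unfolded AE_completion_iff] \<Phi>0(2) A0(2)
    proof eventually_elim
      case (elim y)
      then show ?case using closure_subset[THEN subsetD, of y "{z. \<Phi> z \<noteq> 0}"] by auto
    qed
    let ?I = "comm_integrand \<Phi> A b f" and ?J = "comm_integrand \<Phi>0 A0 b0 f0"
    let ?T = "hausdorff_comm \<Phi> A b f" and ?S = "\<lambda>x. \<integral>\<^sup>+y. ennreal (norm (?J x y)) \<partial>lborel"
    let ?R = "\<lambda>x. LINT y|lborel. ?J x y"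
    have I_eq: "AE x in lborel. AE y in lborel. ?I x y = ?J x y"
      by (rule comm_integrand_borel_AE[OF \<Phi>0(1) A0(1) \<Phi>0(2) A0(2) b0(2) f0(2) det0])
    have meas: "(\<lambda>(x, y). ?J x y) \<in> borel_measurable (lborel \<Otimes>\<^sub>M lborel)"
      by (rule measurable_comm_integrand[OF \<Phi>0(1) A0(1) b0(1) f0(1)])
    have meas_x: "?J x \<in> borel_measurable borel" for x
      using measurable_compose[OF measurable_Pair1' meas, of x] by simp
    have T_eq: "AE x in lborel. ?T x = ?R x"
      using I_eq
    proof eventually_elim
      case (elim x)
      have "?T x = (LINT y|lebesgue. ?J x y)"
        unfolding hausdorff_comm_def
        by (rule integral_cong_AE)
          (use lebesgue_measurable_cong_AE[OF meas_x elim] meas_x[of x] AE_completion[OF elim] in \<open>auto intro: measurable_completion\<close>)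
      also have "\<dots> = ?R x" by (rule integral_completion) (use meas_x in simp)
      finally show ?case .
    qed
    have T0_meas: "?R \<in> borel_measurable borel"
      using lborel.borel_measurable_lebesgue_integral[OF meas] by simp
    have T_meas: "?T \<in> borel_measurable lebesgue"
      by (rule lebesgue_measurable_cong_AE[OF T0_meas T_eq])
    have K0: "K3 q q1 \<alpha>1 \<beta> \<Phi> A = (\<integral>\<^sup>+y. kernel_bound q q1 \<alpha>1 \<beta> \<Phi>0 A0 y \<partial>lborel)"
      unfolding K3_eq
      by (rule nn_integral_cong_AE, use \<Phi>0(2) A0(2) in eventually_elim) (rule kernel_bound_cong)
    define w where "w \<alpha> k = ennreal (c0 powr (\<alpha> / ?Q) * 2 powr (of_int k * (s * (\<alpha> / ?Q))))" for \<alpha> and k :: int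
    have w_pos: "w \<alpha> k \<noteq> 0" for \<alpha> k using c0 by (simp add: w_def ennreal_eq_0_iff not_le)
    let ?P = "pnorm (count_space (UNIV :: int set)) p"
    let ?a = "\<lambda>k. pnorm (hweight \<beta>) q1 (\<lambda>x. ennreal (norm (f0 x)) * indicator (hE k) x)"
    have F_eq: "herz_norm \<alpha>1 p q1 v f = ?P (\<lambda>k. w \<alpha>1 k * ?a k)"
      unfolding assms(6) w_def by (rule herz_norm_eq_pnorm) (use assms(1,3) c0 vol f0 in auto)
    have F_fin: "herz_norm \<alpha>1 p q1 v f < \<infinity>" using f by (simp add: herz_def)
    let ?L = "?P (\<lambda>k. w \<alpha>2 k * pnorm (hweight \<beta>) q2 (\<lambda>x. ?S x * indicator (hE k) x))"
    \<comment> \<open>Here \<open>N\<close> is any positive number above the oscillation norm; the norm itself may be \<open>0\<close>.\<close>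
    have bound: "?L \<le> ennreal (C * N) * K3 q q1 \<alpha>1 \<beta> \<Phi> A * herz_norm \<alpha>1 p q1 v f"
      if N: "N > 0" "cmo_norm q v b \<le> ennreal N" for N
    proof -
      interpret commutator_setting q \<beta> s c0 N b0 "\<lambda>k. average (hB k) b" "\<lambda>k. epowr (emeasure (hweight \<beta>) (hB k :: 'n heis set)) (1 / q)"
        p q1 q2 \<alpha>1 \<alpha>2 ?Q f0 \<Phi>0 A0 "w \<alpha>1" "w \<alpha>2"
        "\<lambda>k y. pnorm (hweight \<beta>) q2 (\<lambda>x. ennreal (norm (?J x y)) * indicator (hE k) x)" ?a
      proof
        fix k
        have "pnorm (hweight \<beta>) q (\<lambda>x. ennreal (norm (b0 x - average (hB k) b)) * indicator (hB k) x)
          \<le> cmo_norm q v b * epowr (emeasure (hweight \<beta>) (hB k :: 'n heis set)) (1 / q)"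
          unfolding assms(6) by (rule cmo_norm_ball) (use assms(2) c0 vol b0 in auto)
        also have "\<dots> \<le> ennreal N * epowr (emeasure (hweight \<beta>) (hB k :: 'n heis set)) (1 / q)"
          by (intro mult_right_mono N(2)) simp
        finally show "pnorm (hweight \<beta>) q (\<lambda>x. ennreal (norm (b0 x - average (hB k) b)) * indicator (hB k) x)
          \<le> ennreal N * epowr (emeasure (hweight \<beta>) (hB k :: 'n heis set)) (1 / q)" .
        show "emeasure (hweight \<beta>) (hB k :: 'n heis set) = ennreal (c0 * 2 powr (of_int k * s))"
          using vol[of k] by (simp add: wmeasure_hweight)
      qed (use assms s N(1) c0 b0(1) f0(1) \<Phi>0(1) A0(1) det0 in \<open>auto simp: s_def w_def\<close>)
      show ?thesis
        using herz_commutator_le F_fin unfolding F_eq[symmetric] K0[symmetric]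
        by (simp add: C_def mult_ac)
    qed
    have N_fin: "cmo_norm q v b < \<infinity>" using b by (simp add: cmo_def)
    then obtain N0 where N0: "N0 \<ge> 0" "cmo_norm q v b = ennreal N0" by (cases "cmo_norm q v b") auto
    have L_le: "?L \<le> ennreal C * K3 q q1 \<alpha>1 \<beta> \<Phi> A * cmo_norm q v b * herz_norm \<alpha>1 p q1 v f"
    proof -
      let ?X = "ennreal C * K3 q q1 \<alpha>1 \<beta> \<Phi> A * herz_norm \<alpha>1 p q1 v f"
      have "?X < \<infinity>" using K3 F_fin by (simp add: ennreal_mult_less_top)
      moreover have "?L \<le> ?X * ennreal N" if "N > N0" for N
      proof -
        have "?L \<le> ennreal (C * N) * K3 q q1 \<alpha>1 \<beta> \<Phi> A * herz_norm \<alpha>1 p q1 v f"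
          by (rule bound) (use that N0 in \<open>simp_all add: ennreal_leI\<close>)
        also have "\<dots> = ?X * ennreal N"
          unfolding ennreal_mult'[OF less_imp_le[OF C]] by (simp only: mult_ac)
        finally show ?thesis .
      qed
      ultimately have "?L \<le> ?X * ennreal N0" by (rule ennreal_mult_right_limit[OF _ N0(1)])
      also have "\<dots> = ennreal C * K3 q q1 \<alpha>1 \<beta> \<Phi> A * cmo_norm q v b * herz_norm \<alpha>1 p q1 v f"
        unfolding N0(2) by (simp only: mult_ac)
      finally show ?thesis .
    qed
    also have "\<dots> < \<infinity>" using K3 F_fin N_fin by (simp add: ennreal_mult_less_top)
    finally have L_fin: "?L < \<infinity>" .
    have S_meas: "?S \<in> borel_measurable borel"
    proof -
      have "(\<lambda>(x, y). ennreal (norm (?J x y))) \<in> borel_measurable (lborel \<Otimes>\<^sub>M lborel)"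
        using meas unfolding case_prod_beta by measurable
      from lborel.borel_measurable_nn_integral[OF this] show ?thesis by simp
    qed
    \<comment> \<open>A finite Herz norm of the absolute integral \<open>?S\<close> forces it to be finite almost everywhere on each shell.\<close>
    have "AE x in lborel. \<forall>k. x \<in> hE k \<longrightarrow> ?S x \<noteq> \<infinity>"
    proof (subst AE_all_countable, rule allI)
      fix k
      have "pnorm (hweight \<beta>) q2 (\<lambda>x. ?S x * indicator (hE k) x) < \<infinity>"
        by (rule pnorm_finite_imp_component_finite[OF _ L_fin w_pos]) (use assms(1) in simp)
      then have fin: "(\<integral>\<^sup>+x. epowr (?S x * indicator (hE k) x) q2 \<partial>hweight \<beta>) \<noteq> \<infinity>"
        using assms(4) by (auto simp: pnorm_def)
      have "(\<lambda>x. epowr (?S x * indicator (hE k) x) q2) \<in> borel_measurable (hweight \<beta>)"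
        unfolding measurable_hweight by (intro measurable_epowr borel_measurable_times_ennreal S_meas borel_measurable_indicator sets_hE)
      from nn_integral_PInf_AE[OF this fin]
      have "AE x in lborel. epowr (?S x * indicator (hE k) x) q2 \<noteq> \<infinity>"
        unfolding AE_hweight .
      then show "AE x in lborel. x \<in> hE k \<longrightarrow> ?S x \<noteq> \<infinity>"
      proof eventually_elim
        case (elim x)
        then show ?case using assms(4) by (auto simp del: infinity_ennreal_def simp: epowr_top[unfolded infinity_ennreal_def[symmetric]])
      qed
    qed
    then have S_fin: "AE x in lborel. ?S x < \<infinity>"
      using AE_lborel_neq_0
    proof eventually_elim
      case (elim x)
      then show ?case using ex_hE[of x] by (auto simp: less_top)
    qed
    have integrable_I: "AE x in lebesgue. integrable lebesgue (?I x)"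
    proof (rule AE_completion, use I_eq S_fin in eventually_elim)
      case (elim x)
      have "integrable lborel (?J x)"
        using elim(2) meas_x[of x] by (intro integrableI_bounded) auto
      then have "integrable lebesgue (?J x)" using meas_x[of x] by (simp add: integrable_completion)
      then show ?case
        using lebesgue_measurable_cong_AE[OF meas_x elim(1)] AE_completion[OF elim(1)]
        by (subst integrable_cong_AE[of _ _ "?J x"]) (auto dest: borel_measurable_integrable)
    qed
    have herz_T: "herz_norm \<alpha>2 p q2 v ?T = ?P (\<lambda>k. w \<alpha>2 k * pnorm (hweight \<beta>) q2 (\<lambda>x. ennreal (norm (?R x)) * indicator (hE k) x))"
      unfolding assms(6) w_def by (rule herz_norm_eq_pnorm) (use assms(1,4) c0 vol T0_meas T_eq in auto)
    have "ennreal (norm (?R x)) \<le> ?S x" for x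
      by (cases "integrable lborel (?J x)") (auto intro: integral_norm_bound_ennreal simp: not_integrable_integral_eq)
    then have R_le: "pnorm (hweight \<beta>) q2 (\<lambda>x. ennreal (norm (?R x)) * indicator (hE k) x) \<le> pnorm (hweight \<beta>) q2 (\<lambda>x. ?S x * indicator (hE k) x)" for k
      using assms(4) by (intro pnorm_mono_AE AE_I2 mult_right_mono) auto
    have T_le: "herz_norm \<alpha>2 p q2 v ?T \<le> ?L"
      unfolding herz_T
      by (rule pnorm_mono_AE, use assms(1) in simp, rule AE_I2, rule mult_left_mono[OF R_le]) simp
    then have T_fin: "herz_norm \<alpha>2 p q2 v ?T < \<infinity>" using L_fin by (rule le_less_trans)
    have "?T \<in> Lloc (- {0}) q2 v"
    proof (rule Lloc_punctured[OF _ T_meas])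
      fix k
      have "pnorm (hweight \<beta>) q2 (\<lambda>x. ennreal (norm (?R x)) * indicator (hE k) x) < \<infinity>"
        by (rule pnorm_finite_imp_component_finite[OF _ T_fin[unfolded herz_T] w_pos]) (use assms(1) in simp)
      then show "Lnorm (hE k) q2 v ?T < \<infinity>"
        unfolding assms(6) using assms(4) by (subst Lnorm_eq_pnorm[OF _ sets_hE T0_meas T_eq]) auto
    qed (use assms(4,6) in auto)
    with T_fin have "?T \<in> herz \<alpha>2 p q2 v" by (simp add: herz_def)
    with integrable_I order_trans[OF T_le L_le]
    show "(AE x in lebesgue. integrable lebesgue (?I x)) \<and> ?T \<in> herz \<alpha>2 p q2 v
      \<and> herz_norm \<alpha>2 p q2 v ?T \<le> ennreal C * K3 q q1 \<alpha>1 \<beta> \<Phi> A * cmo_norm q v b * herz_norm \<alpha>1 p q1 v f"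
      by blast
  qed
qed

end
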